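(* Let $K\subset\mathbb{R}^d$ be a non-singleton self-similar set admitting a generating iterated function system satisfying the strong separation condition (SSC). Let $h:\mathbb{R}^d\to\mathbb{R}^d$ be a contracting similitude such that $h(K)\subseteq K$. Then the following are equivalent: (i) $h(K)$ is relatively open in $K$; (ii) there exists a finite generating iterated function system of contracting similitudes of $K$ satisfying the open set condition (OSC) that contains $h$; (iii) there exists a finite generating iterated function system of contracting similitudes of $K$ satisfying the SSC that contains $h$. Moreover, if one of these conditions holds, then for every fixed generating iterated function system $\Psi=\{\psi_j\}_{j=1}^n$ of $K$ satisfying the SSC, there exist an integer $\ell\geq 1$ and a set $\mathcal{J}\subseteq\{1,\ldots,n\}^{\ell}$ such that $$\{h\}\cup\bigl\{\psi_{j_1}\circ\cdots\circ\psi_{j_\ell}:(j_1,\ldots,j_\ell)\in\mathcal{J}\bigr\}$$ is a generating iterated function system of $K$ satisfying the SSC.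
   Context: Here $d\geq 1$ is an integer. A contracting similitude on $\mathbb{R}^d$ is a map of the form $\phi(x)=aOx+t$ with $0<a<1$, $t\in\mathbb{R}^d$ and $O$ an orthogonal transformation of $\mathbb{R}^d$; $a$ is its contraction ratio. An iterated function system (IFS) of contracting similitudes on $\mathbb{R}^d$ is a finite family $\Phi=\{\phi_i\}_{i=1}^m$, $m\geq 2$, of contracting similitudes on $\mathbb{R}^d$ (contraction ratios and orthogonal parts may vary with $i$). Its attractor is the unique non-empty compact set $K\subset\mathbb{R}^d$ with $K=\bigcup_{i=1}^m\phi_i(K)$. A self-similar set is the attractor of such an IFS, and a generating IFS of $K$ is a finite IFS of contracting similitudes on $\mathbb{R}^d$ whose attractor is $K$. An IFS contains $h$ if $h$ is one of its maps. $\Phi$ satisfies the open set condition (OSC) if there is a non-empty open set $U\subset\mathbb{R}^d$ such that $\phi_1(U),\ldots,\phi_m(U)$ are pairwise disjoint subsets of $U$. $\Phi$ satisfies the strong separation condition (SSC) if $\phi_1(K),\ldots,\phi_m(K)$ are pairwise disjoint (i.e. $\phi_i(K)\cap\phi_{i'}(K)=\varnothing$ for all $i\neq i'$), where $K$ is the attractor of $\Phi$. *)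

theory Defs
  imports "HOL-Analysis.Analysis"
begin

definition contracting_similitude :: "(real ^ 'd \<Rightarrow> real ^ 'd) \<Rightarrow> bool" where
  "contracting_similitude f \<longleftrightarrow>
     (\<exists>a T t. 0 < a \<and> a < 1 \<and> orthogonal_transformation T \<and> f = (\<lambda>x. a *\<^sub>R T x + t))"

text \<open>Iterated function systems are families indexed by a finite set, so a map may occur
  repeatedly. A set \<open>F\<close> of maps is regarded as the family \<open>\<lambda>f. f\<close> indexed by \<open>F\<close> itself.\<close>

definition ifs :: "'i set \<Rightarrow> ('i \<Rightarrow> real ^ 'd \<Rightarrow> real ^ 'd) \<Rightarrow> bool" where
  "ifs I \<phi> \<longleftrightarrow> finite I \<and> 2 \<le> card I \<and> (\<forall>i\<in>I. contracting_similitude (\<phi> i))"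

definition is_attractor ::
    "'i set \<Rightarrow> ('i \<Rightarrow> real ^ 'd \<Rightarrow> real ^ 'd) \<Rightarrow> (real ^ 'd) set \<Rightarrow> bool" where
  "is_attractor I \<phi> K \<longleftrightarrow> K \<noteq> {} \<and> compact K \<and> K = (\<Union>i\<in>I. \<phi> i ` K)"

definition attractor :: "'i set \<Rightarrow> ('i \<Rightarrow> real ^ 'd \<Rightarrow> real ^ 'd) \<Rightarrow> (real ^ 'd) set" where
  "attractor I \<phi> = (THE K. is_attractor I \<phi> K)"

definition generating_ifs ::
    "'i set \<Rightarrow> ('i \<Rightarrow> real ^ 'd \<Rightarrow> real ^ 'd) \<Rightarrow> (real ^ 'd) set \<Rightarrow> bool" where
  "generating_ifs I \<phi> K \<longleftrightarrow> ifs I \<phi> \<and> is_attractor I \<phi> K"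

definition self_similar :: "(real ^ 'd) set \<Rightarrow> bool" where
  "self_similar K \<longleftrightarrow> (\<exists>(m::nat) \<phi>. generating_ifs {1..m} \<phi> K)"

definition osc :: "'i set \<Rightarrow> ('i \<Rightarrow> real ^ 'd \<Rightarrow> real ^ 'd) \<Rightarrow> bool" where
  "osc I \<phi> \<longleftrightarrow>
     (\<exists>U. open U \<and> U \<noteq> {} \<and> (\<forall>i\<in>I. \<phi> i ` U \<subseteq> U) \<and> disjoint_family_on (\<lambda>i. \<phi> i ` U) I)"

definition ssc :: "'i set \<Rightarrow> ('i \<Rightarrow> real ^ 'd \<Rightarrow> real ^ 'd) \<Rightarrow> bool" where
  "ssc I \<phi> \<longleftrightarrow> disjoint_family_on (\<lambda>i. \<phi> i ` attractor I \<phi>) I"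

text \<open>\<open>word_map \<psi> [j\<^sub>1, \<dots>, j\<^sub>l] = \<psi> j\<^sub>1 \<circ> \<dots> \<circ> \<psi> j\<^sub>l\<close>\<close>

definition word_map :: "('i \<Rightarrow> 'a \<Rightarrow> 'a) \<Rightarrow> 'i list \<Rightarrow> 'a \<Rightarrow> 'a" where
  "word_map \<psi> js = foldr (\<lambda>j f. \<psi> j \<circ> f) js id"

lemma contracting_similitude_dist:
  assumes "contracting_similitude f"
  obtains a where "0 < a" "a < 1" "\<And>x y. dist (f x) (f y) = a * dist x y"
proof -
  obtain a T t where a: "0 < a" "a < 1" and T: "orthogonal_transformation T"
    and f: "f = (\<lambda>x. a *\<^sub>R T x + t)"
    using assms unfolding contracting_similitude_def by blast
  have "dist (f x) (f y) = a * dist x y" for x y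
  proof -
    have "f x - f y = a *\<^sub>R T (x - y)"
      using T by (simp add: f orthogonal_transformation_linear linear_diff scaleR_diff_right)
    then show ?thesis
      using T a by (simp add: dist_norm orthogonal_transformation_norm)
  qed
  with a show ?thesis using that by blast
qed

lemma is_attractor_subset:
  assumes "ifs I \<phi>" "is_attractor I \<phi> K" "is_attractor I \<phi> L"
  shows "K \<subseteq> L"
proof -
  have K: "K \<noteq> {}" "compact K" "K = (\<Union>i\<in>I. \<phi> i ` K)"
    and L: "L \<noteq> {}" "compact L" "L = (\<Union>i\<in>I. \<phi> i ` L)"
    using assms unfolding is_attractor_def by auto
  obtain x where x: "x \<in> K" and max: "\<And>y. y \<in> K \<Longrightarrow> infdist y L \<le> infdist x L"
    using continuous_attains_sup[OF K(2,1), of "\<lambda>y. infdist y L"]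
    using continuous_on_infdist[OF continuous_on_id] by blast
  from x K(3) obtain i y where i: "i \<in> I" and y: "y \<in> K" and xy: "x = \<phi> i y" by blast
  obtain a where a: "0 < a" "a < 1" and d: "\<And>u v. dist (\<phi> i u) (\<phi> i v) = a * dist u v"
    using assms(1) i unfolding ifs_def by (meson contracting_similitude_dist)
  obtain z where z: "z \<in> L" "infdist y L = dist y z"
    using infdist_attains_inf[OF compact_imp_closed[OF L(2)] L(1)] by blast
  have "\<phi> i z \<in> L" using i z(1) L(3) by blast
  then have "infdist x L \<le> dist x (\<phi> i z)" by (rule infdist_le)
  also have "\<dots> = a * infdist y L" by (simp add: xy d z(2))
  also have "\<dots> \<le> a * infdist x L" using max[OF y] a by simp
  finally have "(1 - a) * infdist x L \<le> 0" by (simp add: algebra_simps)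
  then have "infdist x L \<le> 0" using a by (simp add: mult_le_0_iff)
  then have "infdist y L = 0" if "y \<in> K" for y
    using max[OF that] infdist_nonneg[of y L] by linarith
  then show ?thesis
    using in_closed_iff_infdist_zero[OF compact_imp_closed[OF L(2)] L(1)] by blast
qed

lemma attractor_eq:
  assumes "generating_ifs I \<phi> K"
  shows "attractor I \<phi> = K"
proof -
  have "ifs I \<phi>" "is_attractor I \<phi> K"
    using assms unfolding generating_ifs_def by auto
  then show ?thesis
    unfolding attractor_def
    by (intro the_equality subset_antisym) (blast intro: is_attractor_subset[THEN subsetD])+
qed

end

theory Submission
  imports Defs
begin

text \<open>The crux is that an open set condition system \<open>\<phi>\<close> of \<open>K\<close> satisfies the SSC as soon as some system
  \<open>\<psi>\<close> of \<open>K\<close> does. Let \<open>N(\<epsilon>)\<close> be the number of \<open>\<epsilon>\<close>-chain components of \<open>K\<close>, let \<open>a\<^sub>i\<close>, \<open>b\<^sub>j\<close> be the ratios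
  of \<open>\<phi>\<close>, \<open>\<psi>\<close>, and let \<open>\<Sum>b\<^sub>j\<^sup>s = 1\<close>. The SSC gives \<open>N(\<epsilon>) = \<Sum>N(\<epsilon>/b\<^sub>j)\<close> for small \<open>\<epsilon>\<close>, so \<open>N(\<epsilon>)\<epsilon>\<^sup>s\<close> is
  bounded, and a packing argument with the OSC then gives \<open>\<Sum>a\<^sub>i\<^sup>s \<le> 1\<close>. If two pieces \<open>\<phi>\<^sub>i(K)\<close> met, the
  defect \<open>F(\<epsilon>) = \<Sum>N(\<epsilon>/a\<^sub>i) - N(\<epsilon>)\<close> would be at least 1; but \<open>F\<close> also satisfies \<open>F(\<epsilon>) = \<Sum>F(\<epsilon>/b\<^sub>j)\<close>, hence
  \<open>F(\<epsilon>)\<epsilon>\<^sup>s\<close> is bounded below by some \<open>c > 0\<close>. Iterating \<open>N(\<epsilon>)\<epsilon>\<^sup>s \<le> \<Sum>a\<^sub>i\<^sup>s N(\<epsilon>/a\<^sub>i)(\<epsilon>/a\<^sub>i)\<^sup>s - c\<close> would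
  make \<open>N\<close> negative.
  If \<open>h(K)\<close> is open in \<open>K\<close>, then it has positive distance to \<open>K - h(K)\<close>, so sufficiently small cylinders of
  any SSC system lie in \<open>h(K)\<close> or miss it; the latter ones together with \<open>h\<close> form the required system.\<close>

section \<open>Scaling inequalities\<close>

locale ratios =
  fixes I :: "'i set" and b :: "'i \<Rightarrow> real"
  assumes finite_I: "finite I" and I_nonempty: "I \<noteq> {}"
    and b_pos: "i \<in> I \<Longrightarrow> 0 < b i" and b_less_1: "i \<in> I \<Longrightarrow> b i < 1"
begin

lemma lower_bound:
  obtains lo where "0 < lo" "lo < 1" "\<And>i. i \<in> I \<Longrightarrow> lo \<le> b i"
proof
  have "Min (b ` I) \<in> b ` I" using finite_I I_nonempty by simp
  then show "0 < Min (b ` I)" "Min (b ` I) < 1" using b_pos b_less_1 by auto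
qed (use finite_I in auto)

lemma upper_bound:
  obtains hi where "0 < hi" "hi < 1" "\<And>i. i \<in> I \<Longrightarrow> b i \<le> hi"
proof
  have "Max (b ` I) \<in> b ` I" using finite_I I_nonempty by simp
  then show "0 < Max (b ` I)" "Max (b ` I) < 1" using b_pos b_less_1 by auto
qed (use finite_I in auto)

text \<open>Dividing by a ratio enlarges \<open>\<epsilon>\<close> by at least the factor
  \<open>1 / hi > 1\<close>, so finitely many divisions bring every positive scale up to
  \<open>\<delta>\<close>.\<close>

lemma scale_induct [consumes 2, case_names base step]:
  assumes "0 < \<delta>" "0 < (\<epsilon>::real)"
    and base: "\<And>\<epsilon>. \<delta> \<le> \<epsilon> \<Longrightarrow> P \<epsilon>"
    and step: "\<And>\<epsilon>. 0 < \<epsilon> \<Longrightarrow> \<epsilon> < \<delta> \<Longrightarrow> (\<And>i. i \<in> I \<Longrightarrow> P (\<epsilon> / b i)) \<Longrightarrow> P \<epsilon>"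
  shows "P \<epsilon>"
proof -
  obtain hi where hi: "0 < hi" "hi < 1" "\<And>i. i \<in> I \<Longrightarrow> b i \<le> hi" using upper_bound by blast
  obtain k where "hi ^ k < \<epsilon> / \<delta>"
    using real_arch_pow_inv[OF _ hi(2), of "\<epsilon> / \<delta>"] assms(1,2) by auto
  \<comment> \<open>\<open>k\<close> bounds the number of divisions left before the base range is
    reached; the induction runs over it.\<close>
  then have "\<delta> * hi ^ k \<le> \<epsilon>" using assms(1) by (simp add: field_simps)
  then show ?thesis using \<open>0 < \<epsilon>\<close>
  proof (induction k arbitrary: \<epsilon>)
    case 0
    then show ?case using base by simp
  next
    case (Suc k)
    show ?case
    proof (cases "\<epsilon> < \<delta>")
      case True
      show ?thesis
      proof (rule step[OF Suc.prems(2) True])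
        fix i assume i: "i \<in> I"
        have "\<delta> * hi ^ k \<le> \<epsilon> / hi" using Suc.prems(1) hi(1) by (simp add: field_simps)
        also have "\<dots> \<le> \<epsilon> / b i"
          using hi(3)[OF i] b_pos[OF i] Suc.prems(2) by (simp add: frac_le)
        finally show "P (\<epsilon> / b i)" using Suc.IH Suc.prems(2) b_pos[OF i] by simp
      qed
    qed (use base in auto)
  qed
qed

text \<open>If \<open>(\<Sum>i\<in>I. b i powr s) = 1\<close>, then
  \<open>\<epsilon> powr - s\<close> solves the renewal equation
  \<open>N \<epsilon> = (\<Sum>i\<in>I. N (\<epsilon> / b i))\<close>; it is the comparison function
  in the estimates below.\<close>

lemma powr_sum_scale:
  assumes "0 < \<epsilon>"
  shows "(\<Sum>i\<in>I. (\<epsilon> / b i) powr - s) = (\<Sum>i\<in>I. b i powr s) * \<epsilon> powr - s"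
  unfolding sum_distrib_right
proof (rule sum.cong)
  fix i assume "i \<in> I"
  then have "0 < b i" by (rule b_pos)
  then show "(\<epsilon> / b i) powr - s = b i powr s * \<epsilon> powr - s"
    using assms by (simp add: powr_divide powr_minus field_simps)
qed simp

text \<open>Intermediate value theorem: the sum is continuous in \<open>s\<close>, equals
  \<open>card I \<ge> 2\<close> at 0 and is at most 1 at a large integer \<open>k\<close>.\<close>

lemma similarity_dimension:
  assumes "2 \<le> card I"
  obtains s where "0 < s" "(\<Sum>i\<in>I. b i powr s) = 1"
proof -
  let ?f = "\<lambda>s. \<Sum>i\<in>I. b i powr s"
  obtain hi where hi: "0 < hi" "hi < 1" "\<And>i. i \<in> I \<Longrightarrow> b i \<le> hi" using upper_bound by blast
  obtain k where k: "hi ^ k < 1 / card I"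
    using real_arch_pow_inv[OF _ hi(2), of "1 / card I"] assms by auto
  have "?f (real k) \<le> (\<Sum>i\<in>I. hi ^ k)"
    using b_pos hi by (intro sum_mono) (simp add: powr_realpow power_mono less_imp_le)
  also have "\<dots> \<le> 1" using k assms by (simp add: field_simps)
  finally have "?f (real k) \<le> 1" .
  moreover have f0: "?f 0 = real (card I)" using b_pos by (simp add: less_imp_neq[symmetric])
  moreover have "\<forall>s. 0 \<le> s \<and> s \<le> real k \<longrightarrow> isCont ?f s"
    using b_pos by (auto intro!: continuous_intros simp: less_imp_neq[symmetric])
  ultimately obtain s where s: "0 \<le> s" "?f s = 1"
    using IVT2[of ?f "real k" 1 0] assms by auto
  then have "s \<noteq> 0" using f0 assms by auto
  then show ?thesis using s that[of s] by simp
qed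

text \<open>By continuity the strict inequality survives a small increase of the exponent. The
  strictly larger \<open>t\<close> will contradict a growth bound of order \<open>s\<close>.\<close>

lemma similarity_dimension_greater:
  assumes "1 < (\<Sum>i\<in>I. b i powr s)"
  obtains t where "s < t" "1 \<le> (\<Sum>i\<in>I. b i powr t)"
proof -
  let ?f = "\<lambda>s. \<Sum>i\<in>I. b i powr s"
  have "isCont ?f s"
    using b_pos by (auto intro!: continuous_intros simp: less_imp_neq[symmetric])
  then have "(?f \<longlongrightarrow> ?f s) (at_right s)"
    by (simp add: isCont_def filterlim_at_split)
  then have "\<forall>\<^sub>F t in at_right s. 1 < ?f t" using assms by (rule order_tendstoD)
  then have "\<forall>\<^sub>F t in at_right s. 1 < ?f t \<and> s < t"
    by (intro eventually_conj) (simp_all add: eventually_at_right_less)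
  from eventually_happens'[OF _ this] show ?thesis using that
    by (metis less_imp_le trivial_limit_at_right_real)
qed

section \<open>Comparison of counting functions with powers of the scale\<close>

text \<open>\<open>C * \<epsilon> powr - s\<close> is a supersolution of the step inequality, so it
  dominates \<open>N\<close> at small scales once it does so on the window from
  \<open>\<delta>\<close> to \<open>\<delta> / lo\<close>; \<open>C\<close> is chosen for that
  window.\<close>

lemma scale_upper:
  assumes s: "0 \<le> s" "(\<Sum>i\<in>I. b i powr s) \<le> 1" and "0 < \<delta>" "0 \<le> B"
    and base: "\<And>\<epsilon>. \<delta> \<le> \<epsilon> \<Longrightarrow> N \<epsilon> \<le> B"
    and step: "\<And>\<epsilon>. 0 < \<epsilon> \<Longrightarrow> \<epsilon> < \<delta> \<Longrightarrow> N \<epsilon> \<le> (\<Sum>i\<in>I. N (\<epsilon> / b i))"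
  obtains C where "0 \<le> C" "\<And>\<epsilon>. 0 < \<epsilon> \<Longrightarrow> \<epsilon> < \<delta> \<Longrightarrow> N \<epsilon> \<le> C * \<epsilon> powr - s"
proof -
  obtain lo where lo: "0 < lo" "lo < 1" "\<And>i. i \<in> I \<Longrightarrow> lo \<le> b i" using lower_bound by blast
  define C where "C = B * (\<delta> / lo) powr s"
  have C: "0 \<le> C" unfolding C_def using assms(4) by simp
  \<comment> \<open>The premise \<open>\<epsilon> \<le> \<delta> / lo\<close> keeps the power away
    from 0. It is inherited: if \<open>\<epsilon> < \<delta>\<close>, then
    \<open>\<epsilon> / b i \<le> \<delta> / lo\<close>.\<close>
  have N: "\<epsilon> \<le> \<delta> / lo \<longrightarrow> N \<epsilon> \<le> C * \<epsilon> powr - s" if "0 < \<epsilon>" for \<epsilon>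
    using assms(3) that
  proof (induction rule: scale_induct)
    case (base \<epsilon>)
    show ?case
    proof
      assume *: "\<epsilon> \<le> \<delta> / lo"
      have "0 < \<epsilon>" using base assms(3) by simp
      have "1 = \<epsilon> powr s * \<epsilon> powr - s" using \<open>0 < \<epsilon>\<close> by (simp add: powr_minus)
      also have "\<dots> \<le> (\<delta> / lo) powr s * \<epsilon> powr - s"
        using * \<open>0 < \<epsilon>\<close> s(1) by (intro mult_right_mono powr_mono2) auto
      finally have "B * 1 \<le> B * ((\<delta> / lo) powr s * \<epsilon> powr - s)"
        using assms(4) by (rule mult_left_mono)
      with assms(5)[OF base] show "N \<epsilon> \<le> C * \<epsilon> powr - s"
        unfolding C_def by (simp add: mult.assoc)
    qed
  next
    case (step \<epsilon>)
    have "N (\<epsilon> / b i) \<le> C * (\<epsilon> / b i) powr - s" if i: "i \<in> I" for i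
    proof -
      have "\<epsilon> / b i \<le> \<delta> / lo" using lo(1) lo(3)[OF i] step(1,2) by (intro frac_le) auto
      then show ?thesis using step(3)[OF i] by simp
    qed
    then have "(\<Sum>i\<in>I. N (\<epsilon> / b i)) \<le> (\<Sum>i\<in>I. C * (\<epsilon> / b i) powr - s)" by (rule sum_mono)
    also have "\<dots> = C * ((\<Sum>i\<in>I. b i powr s) * \<epsilon> powr - s)"
      by (simp only: sum_distrib_left[symmetric] powr_sum_scale[OF step(1)])
    also have "\<dots> \<le> C * (1 * \<epsilon> powr - s)"
      using s(2) C by (intro mult_left_mono mult_right_mono) auto
    finally show ?case using assms(6)[OF step(1,2)] by simp
  qed
  have "\<delta> \<le> \<delta> / lo" using lo assms(3) by (simp add: field_simps)
  then show ?thesis using that[OF C] N by fastforce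
qed

text \<open>The dual comparison: for \<open>\<epsilon> \<ge> \<delta>\<close> the left side is at
  most 1, and the ratio sum being exactly 1 carries the bound down to all smaller scales.\<close>

lemma scale_lower:
  assumes s: "0 \<le> s" "(\<Sum>i\<in>I. b i powr s) = 1" and "0 < \<delta>"
    and base: "\<And>\<epsilon>. \<delta> \<le> \<epsilon> \<Longrightarrow> 1 \<le> F \<epsilon>"
    and step: "\<And>\<epsilon>. 0 < \<epsilon> \<Longrightarrow> \<epsilon> < \<delta> \<Longrightarrow> (\<Sum>i\<in>I. F (\<epsilon> / b i)) \<le> F \<epsilon>"
    and "0 < \<epsilon>"
  shows "\<delta> powr s * \<epsilon> powr - s \<le> F \<epsilon>"
  using assms(3,6)
proof (induction rule: scale_induct)
  case (base \<epsilon>)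
  have "0 < \<epsilon>" using base assms(3) by simp
  have "\<delta> powr s * \<epsilon> powr - s \<le> \<epsilon> powr s * \<epsilon> powr - s"
    using base assms(3) s(1) by (intro mult_right_mono powr_mono2) auto
  also have "\<dots> = 1" using \<open>0 < \<epsilon>\<close> by (simp add: powr_minus)
  finally show ?case using assms(4)[OF base] by simp
next
  case (step \<epsilon>)
  have "\<delta> powr s * \<epsilon> powr - s = (\<Sum>i\<in>I. \<delta> powr s * (\<epsilon> / b i) powr - s)"
    by (simp only: sum_distrib_left[symmetric] powr_sum_scale[OF step(1)] s(2) mult_1)
  also have "\<dots> \<le> (\<Sum>i\<in>I. F (\<epsilon> / b i))" using step(3) by (rule sum_mono)
  finally show ?case using assms(5)[OF step(1,2)] by simp
qed

text \<open>Each passage to scales smaller by the factor \<open>lo\<close> lowers the constant in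
  the upper bound by \<open>c\<close>; after enough rounds it is negative, against
  \<open>0 \<le> N \<epsilon>\<close>.\<close>

lemma no_uniform_defect:
  assumes s: "(\<Sum>i\<in>I. b i powr s) \<le> 1" and "0 < \<delta>" "0 < c"
    and nonneg: "\<And>\<epsilon>. 0 < \<epsilon> \<Longrightarrow> 0 \<le> N \<epsilon>"
    and upper: "\<And>\<epsilon>. 0 < \<epsilon> \<Longrightarrow> \<epsilon> < \<delta> \<Longrightarrow> N \<epsilon> \<le> C * \<epsilon> powr - s"
    and defect: "\<And>\<epsilon>. 0 < \<epsilon> \<Longrightarrow> \<epsilon> < \<delta> \<Longrightarrow> N \<epsilon> + c * \<epsilon> powr - s \<le> (\<Sum>i\<in>I. N (\<epsilon> / b i))"
  shows False
proof -
  obtain lo where lo: "0 < lo" "lo < 1" "\<And>i. i \<in> I \<Longrightarrow> lo \<le> b i" using lower_bound by blast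
  have *: "N \<epsilon> \<le> (C - real k * c) * \<epsilon> powr - s" if "0 < \<epsilon>" "\<epsilon> < lo ^ k * \<delta>" for k \<epsilon>
    using that
  proof (induction k arbitrary: \<epsilon>)
    case 0
    then show ?case using upper by simp
  next
    case (Suc k)
    have small: "\<epsilon> / b i < lo ^ k * \<delta>" if i: "i \<in> I" for i
    proof -
      have "\<epsilon> / b i \<le> \<epsilon> / lo" using lo(1) lo(3)[OF i] Suc.prems(1) by (intro frac_le) auto
      also have "\<dots> < lo ^ k * \<delta>" using Suc.prems(2) lo(1) by (simp add: field_simps)
      finally show ?thesis .
    qed
    \<comment> \<open>The sign allows the ratio sum to be replaced by 1 below. It follows from the
      induction hypothesis at a scale \<open>\<epsilon> / b i\<close>, where \<open>N\<close> is
      nonnegative.\<close>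
    have nn: "0 \<le> C - real k * c"
    proof -
      obtain i where i: "i \<in> I" using I_nonempty by blast
      have pos: "0 < \<epsilon> / b i" using Suc.prems(1) b_pos[OF i] by simp
      have "0 \<le> (C - real k * c) * (\<epsilon> / b i) powr - s"
        using nonneg[OF pos] Suc.IH[OF pos small[OF i]] by linarith
      then show ?thesis using Suc.prems(1) b_pos[OF i] by (auto simp: zero_le_mult_iff)
    qed
    have "lo ^ Suc k * \<delta> \<le> 1 * \<delta>"
      using lo assms(2) by (intro mult_right_mono power_le_one) auto
    then have "\<epsilon> < \<delta>" using Suc.prems(2) by simp
    have "N \<epsilon> + c * \<epsilon> powr - s \<le> (\<Sum>i\<in>I. N (\<epsilon> / b i))"
      using defect[OF Suc.prems(1) \<open>\<epsilon> < \<delta>\<close>] .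
    also have "\<dots> \<le> (\<Sum>i\<in>I. (C - real k * c) * (\<epsilon> / b i) powr - s)"
      using Suc.prems(1) b_pos small by (intro sum_mono Suc.IH) auto
    also have "\<dots> = (C - real k * c) * ((\<Sum>i\<in>I. b i powr s) * \<epsilon> powr - s)"
      by (simp only: sum_distrib_left[symmetric] powr_sum_scale[OF Suc.prems(1)])
    also have "\<dots> \<le> (C - real k * c) * (1 * \<epsilon> powr - s)"
      using s nn by (intro mult_left_mono mult_right_mono) auto
    finally show ?case by (simp add: algebra_simps)
  qed
  obtain k where k: "C < real k * c" using assms(3) by (metis ex_less_of_nat_mult)
  define \<epsilon> where "\<epsilon> = lo ^ k * \<delta> / 2"
  have \<epsilon>: "0 < \<epsilon>" "\<epsilon> < lo ^ k * \<delta>" unfolding \<epsilon>_def using lo assms(2) by auto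
  have "(C - real k * c) * \<epsilon> powr - s < 0" using k \<epsilon>(1) by (simp add: mult_neg_pos)
  then show False using *[OF \<epsilon>] nonneg[OF \<epsilon>(1)] by linarith
qed

end

section \<open>Chain components\<close>

definition chain_step :: "real \<Rightarrow> 'a::metric_space set \<Rightarrow> ('a \<times> 'a) set" where
  "chain_step \<epsilon> A = {(x, y). x \<in> A \<and> y \<in> A \<and> dist x y < \<epsilon>}"

definition chain_component :: "real \<Rightarrow> 'a::metric_space set \<Rightarrow> 'a \<Rightarrow> 'a set" where
  "chain_component \<epsilon> A x = (chain_step \<epsilon> A)\<^sup>* `` {x}"

text \<open>For \<open>A = K\<close>, the cardinality of this set is the counting function
  \<open>N(\<epsilon>)\<close>.\<close>

definition chain_components :: "real \<Rightarrow> 'a::metric_space set \<Rightarrow> 'a set set" where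
  "chain_components \<epsilon> A = chain_component \<epsilon> A ` A"

lemma sym_chain_step: "sym (chain_step \<epsilon> A)"
  by (auto simp: sym_def chain_step_def dist_commute)

lemma chain_component_refl: "x \<in> chain_component \<epsilon> A x"
  by (simp add: chain_component_def)

lemma chain_component_eq:
  assumes "(x, y) \<in> (chain_step \<epsilon> A)\<^sup>*"
  shows "chain_component \<epsilon> A x = chain_component \<epsilon> A y"
proof -
  have "(y, x) \<in> (chain_step \<epsilon> A)\<^sup>*"
    using assms sym_rtrancl[OF sym_chain_step] by (meson symE)
  with assms show ?thesis unfolding chain_component_def by (auto intro: rtrancl_trans)
qed

lemma chain_component_close:
  assumes "x \<in> A" "y \<in> A" "dist x y < \<epsilon>"
  shows "chain_component \<epsilon> A x = chain_component \<epsilon> A y"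
  using assms by (intro chain_component_eq r_into_rtrancl) (simp add: chain_step_def)

lemma chain_component_subset:
  assumes "x \<in> A"
  shows "chain_component \<epsilon> A x \<subseteq> A"
proof
  fix y assume "y \<in> chain_component \<epsilon> A x"
  then have "(x, y) \<in> (chain_step \<epsilon> A)\<^sup>*" by (simp add: chain_component_def)
  then show "y \<in> A" using assms by induction (auto simp: chain_step_def)
qed

lemma chain_component_mono:
  assumes "A \<subseteq> B"
  shows "chain_component \<epsilon> A x \<subseteq> chain_component \<epsilon> B x"
proof -
  have "chain_step \<epsilon> A \<subseteq> chain_step \<epsilon> B" using assms by (auto simp: chain_step_def)
  then show ?thesis unfolding chain_component_def by (meson Image_mono order_refl rtrancl_mono)
qed

lemma chain_components_net:
  assumes "X \<subseteq> A" "A \<subseteq> (\<Union>x\<in>X. ball x \<delta>)" "\<delta> \<le> \<epsilon>"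
  shows "chain_components \<epsilon> A \<subseteq> chain_component \<epsilon> A ` X"
  unfolding chain_components_def
proof (rule image_subsetI)
  fix y assume y: "y \<in> A"
  then obtain x where x: "x \<in> X" "dist x y < \<delta>" using assms(2) by auto
  then have "chain_component \<epsilon> A x = chain_component \<epsilon> A y"
    using y assms(1,3) by (intro chain_component_close) auto
  then show "chain_component \<epsilon> A y \<in> chain_component \<epsilon> A ` X" using x(1) by blast
qed

text \<open>A single finite \<open>\<delta>\<close>-net meets every component for all
  \<open>\<epsilon> \<ge> \<delta>\<close>, whence a bound uniform in \<open>\<epsilon>\<close>, as
  the base case of \<open>scale_upper\<close> requires.\<close>

lemma chain_components_bounded:
  fixes A :: "'a::metric_space set"
  assumes "compact A" "0 < \<delta>"
  obtains n where "\<And>\<epsilon>. \<delta> \<le> \<epsilon> \<Longrightarrow> finite (chain_components \<epsilon> A) \<and> card (chain_components \<epsilon> A) \<le> n"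
proof -
  obtain X where X: "finite X" "X \<subseteq> A" "A \<subseteq> (\<Union>x\<in>X. ball x \<delta>)"
    using compactE_image[OF assms(1), of A "\<lambda>x. ball x \<delta>"] assms(2)
    by (metis (no_types, lifting) UN_I centre_in_ball open_ball subsetI)
  have "finite (chain_components \<epsilon> A) \<and> card (chain_components \<epsilon> A) \<le> card X" if "\<delta> \<le> \<epsilon>" for \<epsilon>
    using chain_components_net[OF X(2,3) that] X(1)
    by (meson card_image_le card_mono finite_imageI finite_subset order_trans)
  then show ?thesis using that by blast
qed

lemma finite_chain_components:
  fixes A :: "'a::metric_space set"
  assumes "compact A" "0 < \<epsilon>"
  shows "finite (chain_components \<epsilon> A)"
  using chain_components_bounded[OF assms] by (metis order_refl)

section \<open>Chain components of similar copies and of unions\<close>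

lemma chain_component_similarity:
  assumes f: "\<And>x y. dist (f x) (f y) = a * dist x y" and "0 < a" and "x \<in> A"
  shows "chain_component \<epsilon> (f ` A) (f x) = f ` chain_component (\<epsilon> / a) A x"
proof
  have step: "(x, y) \<in> chain_step (\<epsilon> / a) A \<Longrightarrow> (f x, f y) \<in> chain_step \<epsilon> (f ` A)" for x y
    using assms(2) by (auto simp: chain_step_def f field_simps)
  show "f ` chain_component (\<epsilon> / a) A x \<subseteq> chain_component \<epsilon> (f ` A) (f x)"
  proof (rule image_subsetI)
    fix y assume "y \<in> chain_component (\<epsilon> / a) A x"
    then have "(x, y) \<in> (chain_step (\<epsilon> / a) A)\<^sup>*" by (simp add: chain_component_def)
    then have "(f x, f y) \<in> (chain_step \<epsilon> (f ` A))\<^sup>*"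
      by induction (auto intro: rtrancl_into_rtrancl step)
    then show "f y \<in> chain_component \<epsilon> (f ` A) (f x)" by (simp add: chain_component_def)
  qed
  show "chain_component \<epsilon> (f ` A) (f x) \<subseteq> f ` chain_component (\<epsilon> / a) A x"
  proof
    fix z assume "z \<in> chain_component \<epsilon> (f ` A) (f x)"
    then have "(f x, z) \<in> (chain_step \<epsilon> (f ` A))\<^sup>*" by (simp add: chain_component_def)
    \<comment> \<open>The chain is lifted step by step: each endpoint comes with a preimage reached
      inside \<open>A\<close> by steps shorter than \<open>\<epsilon> / a\<close>.\<close>
    then have "\<exists>y\<in>A. z = f y \<and> (x, y) \<in> (chain_step (\<epsilon> / a) A)\<^sup>*"
    proof induction
      case base
      then show ?case using assms(3) by auto
    next
      case (step z w)
      then obtain y where y: "y \<in> A" "z = f y" "(x, y) \<in> (chain_step (\<epsilon> / a) A)\<^sup>*" by blast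
      from step(2) obtain v where v: "v \<in> A" "w = f v" "dist z w < \<epsilon>"
        by (auto simp: chain_step_def)
      have "(y, v) \<in> chain_step (\<epsilon> / a) A"
        using y v assms(2) by (auto simp: chain_step_def f field_simps)
      then show ?case using y v by (auto intro: rtrancl_into_rtrancl)
    qed
    then show "z \<in> f ` chain_component (\<epsilon> / a) A x" by (auto simp: chain_component_def)
  qed
qed

lemma card_chain_components_similarity:
  assumes f: "\<And>x y. dist (f x) (f y) = a * dist x y" and "0 < a"
  shows "card (chain_components \<epsilon> (f ` A)) = card (chain_components (\<epsilon> / a) A)"
proof -
  have "inj f" using assms by (metis dist_eq_0_iff injI mult_eq_0_iff less_irrefl)
  have "chain_components \<epsilon> (f ` A) = (\<lambda>C. f ` C) ` chain_components (\<epsilon> / a) A"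
    unfolding chain_components_def image_image
    using chain_component_similarity[OF assms] by (intro image_cong) auto
  then show ?thesis
    using \<open>inj f\<close> by (simp add: card_image inj_on_def inj_image_eq_iff)
qed

text \<open>A step shorter than \<open>\<epsilon>\<close> cannot leave its piece, since the other
  pieces are at distance at least \<open>\<epsilon>\<close>.\<close>

lemma chain_component_separated:
  assumes "i \<in> I" "x \<in> A i"
    and sep: "\<And>i j x y. i \<in> I \<Longrightarrow> j \<in> I \<Longrightarrow> i \<noteq> j \<Longrightarrow> x \<in> A i \<Longrightarrow> y \<in> A j \<Longrightarrow> \<epsilon> \<le> dist x y"
  shows "chain_component \<epsilon> (\<Union>i\<in>I. A i) x = chain_component \<epsilon> (A i) x"
proof
  show "chain_component \<epsilon> (A i) x \<subseteq> chain_component \<epsilon> (\<Union>i\<in>I. A i) x"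
    using assms(1) by (intro chain_component_mono) auto
  show "chain_component \<epsilon> (\<Union>i\<in>I. A i) x \<subseteq> chain_component \<epsilon> (A i) x"
  proof
    fix y assume "y \<in> chain_component \<epsilon> (\<Union>i\<in>I. A i) x"
    then have "(x, y) \<in> (chain_step \<epsilon> (\<Union>i\<in>I. A i))\<^sup>*" by (simp add: chain_component_def)
    then have "y \<in> A i \<and> (x, y) \<in> (chain_step \<epsilon> (A i))\<^sup>*"
    proof induction
      case base
      then show ?case using assms by simp
    next
      case (step y z)
      then obtain j where j: "j \<in> I" "z \<in> A j" and d: "dist y z < \<epsilon>"
        by (auto simp: chain_step_def)
      then have "j = i" using sep[OF assms(1) j(1), of y z] step(3) by fastforce
      then have "(y, z) \<in> chain_step \<epsilon> (A i)" using step j d by (auto simp: chain_step_def)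
      then show ?case using step j \<open>j = i\<close> by (auto intro: rtrancl_into_rtrancl)
    qed
    then show "y \<in> chain_component \<epsilon> (A i) x" by (simp add: chain_component_def)
  qed
qed

lemma card_chain_components_separated:
  fixes A :: "'i \<Rightarrow> 'a::metric_space set"
  assumes "finite I" "\<And>i. i \<in> I \<Longrightarrow> compact (A i)" "0 < \<epsilon>"
    and sep: "\<And>i j x y. i \<in> I \<Longrightarrow> j \<in> I \<Longrightarrow> i \<noteq> j \<Longrightarrow> x \<in> A i \<Longrightarrow> y \<in> A j \<Longrightarrow> \<epsilon> \<le> dist x y"
  shows "card (chain_components \<epsilon> (\<Union>i\<in>I. A i)) = (\<Sum>i\<in>I. card (chain_components \<epsilon> (A i)))"
proof -
  have eq: "chain_components \<epsilon> (\<Union>i\<in>I. A i) = (\<Union>i\<in>I. chain_components \<epsilon> (A i))"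
    unfolding chain_components_def image_UN
  proof (intro SUP_cong image_cong refl)
    fix i x assume "i \<in> I" "x \<in> A i"
    then show "chain_component \<epsilon> (\<Union>i\<in>I. A i) x = chain_component \<epsilon> (A i) x"
      using sep by (rule chain_component_separated)
  qed
  have "chain_components \<epsilon> (A i) \<inter> chain_components \<epsilon> (A j) = {}"
    if ij: "i \<in> I" "j \<in> I" "i \<noteq> j" for i j
  proof (rule ccontr)
    assume "\<not> ?thesis"
    then obtain x y where xy: "x \<in> A i" "y \<in> A j" "chain_component \<epsilon> (A i) x = chain_component \<epsilon> (A j) y"
      by (auto simp: chain_components_def)
    then have "x \<in> A j"
      using chain_component_refl[of x \<epsilon> "A i"] chain_component_subset[of y "A j" \<epsilon>] by auto
    then show False using sep[OF ij, of x x] xy assms(3) by simp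
  qed
  then show ?thesis
    unfolding eq using assms(1-3) by (intro card_UN_disjoint) (auto intro!: finite_chain_components)
qed

lemma card_chain_components_overlap:
  fixes A :: "'i \<Rightarrow> 'a::metric_space set"
  assumes "finite I" "\<And>i. i \<in> I \<Longrightarrow> compact (A i)" "0 < \<epsilon>"
    and ij: "i \<in> I" "j \<in> I" "i \<noteq> j" "z \<in> A i" "z \<in> A j"
  shows "card (chain_components \<epsilon> (\<Union>i\<in>I. A i)) + 1 \<le> (\<Sum>i\<in>I. card (chain_components \<epsilon> (A i)))"
proof -
  \<comment> \<open>Pairs retain the index, since one set can be a component of two overlapping
    pieces.\<close>
  let ?S = "SIGMA k:I. chain_components \<epsilon> (A k)"
  \<comment> \<open>The value does not depend on the chosen point, as the fact \<open>g\<close>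
    below shows.\<close>
  define g where "g = (\<lambda>(k::'i, C). chain_component \<epsilon> (\<Union>i\<in>I. A i) (SOME x. x \<in> C))"
  have fin: "finite ?S" using assms(1-3) by (auto intro!: finite_SigmaI finite_chain_components)
  have g: "g (k, chain_component \<epsilon> (A k) x) = chain_component \<epsilon> (\<Union>i\<in>I. A i) x"
    if "k \<in> I" "x \<in> A k" for k x
  proof -
    define y where "y = (SOME y. y \<in> chain_component \<epsilon> (A k) x)"
    have "y \<in> chain_component \<epsilon> (A k) x"
      unfolding y_def using chain_component_refl by (rule someI)
    then have "y \<in> chain_component \<epsilon> (\<Union>i\<in>I. A i) x"
      using chain_component_mono[of "A k" "\<Union>i\<in>I. A i" \<epsilon> x] that by blast
    then show ?thesis
      unfolding g_def y_def[symmetric] prod.case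
      by (metis Image_singleton_iff chain_component_def chain_component_eq)
  qed
  have sub: "chain_components \<epsilon> (\<Union>i\<in>I. A i) \<subseteq> g ` (?S - {(i, chain_component \<epsilon> (A i) z)})"
  proof
    fix C assume "C \<in> chain_components \<epsilon> (\<Union>i\<in>I. A i)"
    then obtain k x where kx: "k \<in> I" "x \<in> A k" "C = chain_component \<epsilon> (\<Union>i\<in>I. A i) x"
      by (auto simp: chain_components_def)
    show "C \<in> g ` (?S - {(i, chain_component \<epsilon> (A i) z)})"
    proof (cases "k = i \<and> chain_component \<epsilon> (A k) x = chain_component \<epsilon> (A i) z")
      case True
      then have "C = g (j, chain_component \<epsilon> (A j) z)" using g[OF kx(1,2)] g ij kx(3) by metis
      then show ?thesis using ij by (auto simp: chain_components_def)
    next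
      case False
      have "C = g (k, chain_component \<epsilon> (A k) x)" using g[OF kx(1,2)] kx(3) by simp
      then show ?thesis using False kx by (auto simp: chain_components_def)
    qed
  qed
  have mem: "(i, chain_component \<epsilon> (A i) z) \<in> ?S" using ij by (auto simp: chain_components_def)
  have "card (chain_components \<epsilon> (\<Union>i\<in>I. A i)) \<le> card (?S - {(i, chain_component \<epsilon> (A i) z)})"
    using sub fin by (meson card_image_le card_mono finite_Diff finite_imageI order_trans)
  also have "\<dots> = card ?S - 1" using mem fin by (simp add: card_Diff_singleton)
  \<comment> \<open>The subtraction is on naturals; by \<open>mem\<close> the set \<open>?S\<close>
    is not empty, so the 1 can be added back.\<close>
  finally have "card (chain_components \<epsilon> (\<Union>i\<in>I. A i)) + 1 \<le> card ?S"
    using mem fin by (metis card_gt_0_iff empty_iff le_diff_conv2 less_one linorder_not_less nat_neq_iff)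
  also have "card ?S = (\<Sum>i\<in>I. card (chain_components \<epsilon> (A i)))"
    using assms(1-3) by (intro card_SigmaI) (auto intro!: finite_chain_components)
  finally show ?thesis .
qed

section \<open>Self-similar systems\<close>

lemma compact_family_gap:
  fixes A :: "'i \<Rightarrow> 'a::heine_borel set"
  assumes "finite I" "\<And>i. i \<in> I \<Longrightarrow> compact (A i)" "disjoint_family_on A I"
  obtains \<delta> where "0 < \<delta>"
    "\<And>i j x y. i \<in> I \<Longrightarrow> j \<in> I \<Longrightarrow> i \<noteq> j \<Longrightarrow> x \<in> A i \<Longrightarrow> y \<in> A j \<Longrightarrow> \<delta> \<le> dist x y"
proof -
  have "\<exists>d>0. \<forall>x\<in>A i. \<forall>y\<in>A j. d \<le> dist x y" if "i \<in> I" "j \<in> I" "i \<noteq> j" for i j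
    using separate_compact_closed[of "A i" "A j"] assms(2,3) that
    by (auto simp: disjoint_family_on_def compact_imp_closed)
  then obtain d where d: "\<And>i j. i \<in> I \<Longrightarrow> j \<in> I \<Longrightarrow> i \<noteq> j \<Longrightarrow>
      0 < d i j \<and> (\<forall>x\<in>A i. \<forall>y\<in>A j. d i j \<le> dist x y)"
    by metis
  let ?P = "{p \<in> I \<times> I. fst p \<noteq> snd p}"
  \<comment> \<open>The inserted 1 keeps the minimum defined when there is no pair of distinct
    indices.\<close>
  define \<delta> where "\<delta> = Min (insert 1 (case_prod d ` ?P))"
  have fin: "finite (case_prod d ` ?P)" using assms(1) by simp
  have "0 < \<delta>" unfolding \<delta>_def using d fin by (auto simp: Min_gr_iff)
  moreover have "\<delta> \<le> dist x y"
    if "i \<in> I" "j \<in> I" "i \<noteq> j" "x \<in> A i" "y \<in> A j" for i j x y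
  proof -
    have "(i, j) \<in> ?P" using that by simp
    then have "\<delta> \<le> d i j" unfolding \<delta>_def using fin by (intro Min_le) force+
    then show ?thesis using d[OF that(1-3)] that(4,5) by fastforce
  qed
  ultimately show ?thesis by (rule that)
qed

text \<open>Moving \<open>c\<close> to the origin and rescaling by \<open>1 / \<epsilon>\<close>
  turns \<open>X\<close> into a 1-separated subset of a fixed ball. Each ball of radius 1/2 in a
  finite cover holds at most one of its points, so \<open>M\<close> depends neither on
  \<open>\<epsilon>\<close> nor on \<open>c\<close>.\<close>

lemma packing_bound:
  obtains M :: nat where "\<And>\<epsilon> X (c::'a::euclidean_space). 0 < \<epsilon> \<Longrightarrow> (\<And>x. x \<in> X \<Longrightarrow> dist c x \<le> L * \<epsilon>)
    \<Longrightarrow> (\<And>x y. x \<in> X \<Longrightarrow> y \<in> X \<Longrightarrow> x \<noteq> y \<Longrightarrow> \<epsilon> \<le> dist x y) \<Longrightarrow> card X \<le> M"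
proof -
  obtain Y where Y: "finite Y" "cball (0::'a) L \<subseteq> (\<Union>y\<in>Y. ball y (1/2))"
    using compact_eq_totally_bounded[of "cball (0::'a) L"] compact_cball[of "0::'a" L]
    by (metis half_gt_zero zero_less_one)
  show ?thesis
  proof
    fix \<epsilon> :: real and X and c :: 'a
    assume \<epsilon>: "0 < \<epsilon>" and X: "\<And>x. x \<in> X \<Longrightarrow> dist c x \<le> L * \<epsilon>"
      and sep: "\<And>x y. x \<in> X \<Longrightarrow> y \<in> X \<Longrightarrow> x \<noteq> y \<Longrightarrow> \<epsilon> \<le> dist x y"
    let ?r = "\<lambda>x. (1 / \<epsilon>) *\<^sub>R (x - c)"
    have "\<exists>y\<in>Y. dist y (?r x) < 1/2" if "x \<in> X" for x
    proof -
      have "norm (?r x) = dist c x / \<epsilon>"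
        using \<epsilon> by (simp add: dist_norm norm_minus_commute del: scaleR_diff_right)
      then have "?r x \<in> cball 0 L"
        using X[OF that] \<epsilon> by (simp add: divide_le_eq)
      then obtain y where "y \<in> Y" "?r x \<in> ball y (1/2)" using Y(2) by blast
      then show ?thesis unfolding mem_ball by blast
    qed
    then obtain q where q: "\<And>x. x \<in> X \<Longrightarrow> q x \<in> Y \<and> dist (q x) (?r x) < 1/2" by metis
    have "inj_on q X"
    proof (rule inj_onI, rule ccontr)
      fix x y assume xy: "x \<in> X" "y \<in> X" "q x = q y" "x \<noteq> y"
      have "dist (?r x) (?r y) < 1"
        using q[OF xy(1)] q[OF xy(2)] xy(3) by (simp add: dist_triangle_half_r[of "q x"])
      also have "dist (?r x) (?r y) = dist x y / \<epsilon>"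
        using \<epsilon> by (simp add: dist_norm flip: scaleR_diff_right)
      finally show False using sep[OF xy(1,2,4)] \<epsilon> by (simp add: field_simps)
    qed
    then show "card X \<le> card Y" using q Y(1) by (intro card_inj_on_le) auto
  qed
qed

locale self_similar_system = ratios I b
  for I :: "'i set" and b :: "'i \<Rightarrow> real" +
  fixes \<phi> :: "'i \<Rightarrow> 'a::heine_borel \<Rightarrow> 'a" and K :: "'a set"
  assumes dist_map: "i \<in> I \<Longrightarrow> dist (\<phi> i x) (\<phi> i y) = b i * dist x y"
    and compact_K: "compact K" and K_nonempty: "K \<noteq> {}"
    and K_eq: "K = (\<Union>i\<in>I. \<phi> i ` K)"
begin

lemma map_in_K: "i \<in> I \<Longrightarrow> x \<in> K \<Longrightarrow> \<phi> i x \<in> K"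
  using K_eq by blast

lemma compact_image_K:
  assumes "i \<in> I"
  shows "compact (\<phi> i ` K)"
proof (rule compact_continuous_image[OF _ compact_K])
  have "(b i)-lipschitz_on K (\<phi> i)"
    using dist_map[OF assms] b_pos[OF assms] by (intro lipschitz_onI) auto
  then show "continuous_on K (\<phi> i)" by (rule lipschitz_on_continuous_on)
qed

text \<open>This is the estimate that the defect \<open>F(\<epsilon>)\<close> is at least 1 once two
  pieces meet.\<close>

lemma components_overlap:
  assumes "i \<in> I" "j \<in> I" "i \<noteq> j" "\<phi> i ` K \<inter> \<phi> j ` K \<noteq> {}" "0 < \<epsilon>"
  shows "card (chain_components \<epsilon> K) + 1 \<le> (\<Sum>i\<in>I. card (chain_components (\<epsilon> / b i) K))"
proof -
  obtain z where "z \<in> \<phi> i ` K" "z \<in> \<phi> j ` K" using assms(4) by blast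
  then have "card (chain_components \<epsilon> (\<Union>i\<in>I. \<phi> i ` K)) + 1 \<le> (\<Sum>i\<in>I. card (chain_components \<epsilon> (\<phi> i ` K)))"
    using finite_I compact_image_K assms(1-3,5) by (intro card_chain_components_overlap)
  also have "(\<Sum>i\<in>I. card (chain_components \<epsilon> (\<phi> i ` K))) = (\<Sum>i\<in>I. card (chain_components (\<epsilon> / b i) K))"
    using dist_map b_pos by (intro sum.cong card_chain_components_similarity) auto
  finally show ?thesis using K_eq by simp
qed

text \<open>Let \<open>\<delta>\<close> be the gap between the pieces. Shorter chains stay in one
  piece, which gives the renewal equation and makes each component the image of one at scale
  \<open>\<epsilon> / b i\<close>; scale induction then bounds the diameters linearly in
  \<open>\<epsilon>\<close>.\<close>

lemma components_separated:
  assumes "disjoint_family_on (\<lambda>i. \<phi> i ` K) I"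
  obtains \<delta> C where "0 < \<delta>"
    "\<And>\<epsilon>. 0 < \<epsilon> \<Longrightarrow> \<epsilon> < \<delta> \<Longrightarrow> card (chain_components \<epsilon> K) = (\<Sum>i\<in>I. card (chain_components (\<epsilon> / b i) K))"
    "\<And>\<epsilon> x y. 0 < \<epsilon> \<Longrightarrow> x \<in> K \<Longrightarrow> y \<in> chain_component \<epsilon> K x \<Longrightarrow> dist x y \<le> C * \<epsilon>"
proof -
  obtain \<delta> where \<delta>: "0 < \<delta>" and sep: "\<And>i j x y. i \<in> I \<Longrightarrow> j \<in> I \<Longrightarrow> i \<noteq> j \<Longrightarrow>
      x \<in> \<phi> i ` K \<Longrightarrow> y \<in> \<phi> j ` K \<Longrightarrow> \<delta> \<le> dist x y"
    using compact_family_gap[of I "\<lambda>i. \<phi> i ` K", OF finite_I compact_image_K assms] by metis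
  \<comment> \<open>Chosen so that \<open>C * \<delta> = diameter K\<close>, which settles all
    scales from \<open>\<delta>\<close> upwards.\<close>
  define C where "C = diameter K / \<delta>"
  have card: "card (chain_components \<epsilon> K) = (\<Sum>i\<in>I. card (chain_components (\<epsilon> / b i) K))"
    if \<epsilon>: "0 < \<epsilon>" "\<epsilon> < \<delta>" for \<epsilon>
  proof -
    have "card (chain_components \<epsilon> (\<Union>i\<in>I. \<phi> i ` K)) = (\<Sum>i\<in>I. card (chain_components \<epsilon> (\<phi> i ` K)))"
      using finite_I compact_image_K \<epsilon>(1) sep \<epsilon>(2)
      by (intro card_chain_components_separated) (auto intro: order_trans[OF less_imp_le])
    also have "\<dots> = (\<Sum>i\<in>I. card (chain_components (\<epsilon> / b i) K))"
      using dist_map b_pos by (intro sum.cong card_chain_components_similarity) auto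
    finally show ?thesis using K_eq by simp
  qed
  have diam: "\<forall>x\<in>K. \<forall>y\<in>chain_component \<epsilon> K x. dist x y \<le> C * \<epsilon>" if "0 < \<epsilon>" for \<epsilon>
    using \<delta> that
  proof (induction rule: scale_induct)
    case (base \<epsilon>)
    have d: "0 \<le> diameter K" using compact_K by (simp add: diameter_ge_0 compact_imp_bounded)
    show ?case
    proof (intro ballI)
      fix x y assume x: "x \<in> K" and y: "y \<in> chain_component \<epsilon> K x"
      have "y \<in> K" using y chain_component_subset[OF x] by blast
      then have "dist x y \<le> diameter K"
        using x compact_K by (intro diameter_bounded_bound compact_imp_bounded)
      also have "\<dots> = C * \<delta>" using \<delta> by (simp add: C_def)
      also have "\<dots> \<le> C * \<epsilon>" using base d \<delta> by (intro mult_left_mono) (auto simp: C_def)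
      finally show "dist x y \<le> C * \<epsilon>" .
    qed
  next
    case (step \<epsilon>)
    show ?case
    proof (intro ballI)
      fix x y assume x: "x \<in> K" and y: "y \<in> chain_component \<epsilon> K x"
      obtain i u where i: "i \<in> I" and u: "u \<in> K" "x = \<phi> i u" using x K_eq by blast
      have "chain_component \<epsilon> (\<Union>i\<in>I. \<phi> i ` K) x = chain_component \<epsilon> (\<phi> i ` K) x"
        using i u sep step(2)
        by (intro chain_component_separated) (auto intro: order_trans[OF less_imp_le])
      then have "chain_component \<epsilon> K x = chain_component \<epsilon> (\<phi> i ` K) (\<phi> i u)"
        using K_eq u(2) by simp
      also have "\<dots> = \<phi> i ` chain_component (\<epsilon> / b i) K u"
        using dist_map[OF i] b_pos[OF i] u(1) by (rule chain_component_similarity)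
      finally obtain v where v: "v \<in> chain_component (\<epsilon> / b i) K u" "y = \<phi> i v" using y by blast
      have "dist x y = b i * dist u v" using dist_map[OF i] u(2) v(2) by simp
      also have "\<dots> \<le> b i * (C * (\<epsilon> / b i))"
        using step(3)[OF i] u(1) v(1) b_pos[OF i] by (intro mult_left_mono) auto
      also have "\<dots> = C * \<epsilon>" using b_pos[OF i] by simp
      finally show "dist x y \<le> C * \<epsilon>" .
    qed
  qed
  show ?thesis using that[OF \<delta> card] diam by blast
qed

section \<open>Packing estimates from the open set condition\<close>

text \<open>Configurations at the scales \<open>\<epsilon> / b i\<close> are copied by the maps and
  united. The copies lie in disjoint images of \<open>U\<close>, so their cardinalities add, and
  \<open>1 \<le> (\<Sum>i\<in>I. b i powr t)\<close> propagates the lower bound.\<close>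

lemma separated_configurations:
  assumes U: "open U" "U \<noteq> {}" "\<And>i. i \<in> I \<Longrightarrow> \<phi> i ` U \<subseteq> U" "disjoint_family_on (\<lambda>i. \<phi> i ` U) I"
    and surj: "\<And>i. i \<in> I \<Longrightarrow> surj (\<phi> i)"
    and t: "0 \<le> t" "1 \<le> (\<Sum>i\<in>I. b i powr t)"
  obtains R c \<rho> where "0 < c" "0 < \<rho>"
    "\<And>\<epsilon>. 0 < \<epsilon> \<Longrightarrow> \<epsilon> \<le> \<rho> \<Longrightarrow> \<exists>X. finite X \<and> (\<forall>x\<in>X. \<exists>y\<in>K. dist x y \<le> R * \<epsilon>) \<and>
      (\<forall>x\<in>X. \<forall>y\<in>X. x \<noteq> y \<longrightarrow> \<epsilon> \<le> dist x y) \<and> c * \<epsilon> powr - t \<le> real (card X)"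
proof -
  obtain lo where lo: "0 < lo" "lo < 1" "\<And>i. i \<in> I \<Longrightarrow> lo \<le> b i" using lower_bound by blast
  obtain x0 where x0: "x0 \<in> U" using U(2) by blast
  obtain \<rho> where \<rho>: "0 < \<rho>" "ball x0 \<rho> \<subseteq> U" using U(1) x0 by (meson open_contains_ball)
  obtain y0 where y0: "y0 \<in> K" using K_nonempty by blast
  \<comment> \<open>\<open>R\<close> and \<open>c\<close> make the single point \<open>x0\<close> a
    valid configuration at all scales between \<open>lo * \<rho>\<close> and
    \<open>\<rho>\<close>.\<close>
  define R where "R = dist x0 y0 / (lo * \<rho>)"
  define c where "c = (lo * \<rho>) powr t"
  \<comment> \<open>Beyond the conclusion, \<open>config\<close> demands that the
    \<open>\<epsilon>\<close>-balls lie in \<open>U\<close>; this keeps copies under different maps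
    \<open>\<epsilon>\<close> apart.\<close>
  define config where "config \<epsilon> X \<longleftrightarrow> finite X \<and> (\<forall>x\<in>X. ball x \<epsilon> \<subseteq> U \<and> (\<exists>y\<in>K. dist x y \<le> R * \<epsilon>)) \<and>
      (\<forall>x\<in>X. \<forall>y\<in>X. x \<noteq> y \<longrightarrow> \<epsilon> \<le> dist x y)" for \<epsilon> X
  have lo\<rho>: "0 < lo * \<rho>" using lo \<rho> by simp
  have c: "0 < c" unfolding c_def using lo \<rho>(1) by simp
  have main: "\<epsilon> \<le> \<rho> \<longrightarrow> (\<exists>X. config \<epsilon> X \<and> c * \<epsilon> powr - t \<le> real (card X))" if "0 < \<epsilon>" for \<epsilon>
    using lo\<rho> that
  proof (induction rule: scale_induct)
    case (base \<epsilon>)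
    show ?case
    proof
      assume "\<epsilon> \<le> \<rho>"
      have "dist x0 y0 = R * (lo * \<rho>)" using lo \<rho>(1) by (simp add: R_def)
      also have "\<dots> \<le> R * \<epsilon>" using base lo\<rho> by (intro mult_left_mono) (auto simp: R_def)
      finally have "config \<epsilon> {x0}"
        unfolding config_def using \<open>\<epsilon> \<le> \<rho>\<close> \<rho>(2) y0 subset_ball[of \<epsilon> \<rho> x0] by auto
      moreover have "c * \<epsilon> powr - t \<le> \<epsilon> powr t * \<epsilon> powr - t"
        unfolding c_def using base lo\<rho> t(1) by (intro mult_right_mono powr_mono2) auto
      then have "c * \<epsilon> powr - t \<le> real (card {x0})" using base lo\<rho> by (simp add: powr_minus)
      ultimately show "\<exists>X. config \<epsilon> X \<and> c * \<epsilon> powr - t \<le> real (card X)" by blast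
    qed
  next
    case (step \<epsilon>)
    have "\<exists>X. config (\<epsilon> / b i) X \<and> c * (\<epsilon> / b i) powr - t \<le> real (card X)" if i: "i \<in> I" for i
    proof -
      have "\<epsilon> / b i \<le> lo * \<rho> / lo" using lo(1) lo(3)[OF i] step(1,2) by (intro frac_le) auto
      then show ?thesis using step(3)[OF i] lo(1) by simp
    qed
    then obtain X where X: "\<And>i. i \<in> I \<Longrightarrow> config (\<epsilon> / b i) (X i)"
      "\<And>i. i \<in> I \<Longrightarrow> c * (\<epsilon> / b i) powr - t \<le> real (card (X i))"
      by metis
    have ball: "ball (\<phi> i x) \<epsilon> \<subseteq> \<phi> i ` U" if i: "i \<in> I" and x: "x \<in> X i" for i x
    proof
      fix z assume z: "z \<in> ball (\<phi> i x) \<epsilon>"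
      \<comment> \<open>By surjectivity \<open>\<phi> i\<close> maps the ball of radius
        \<open>\<epsilon> / b i\<close> onto the whole ball of radius
        \<open>\<epsilon>\<close>.\<close>
      obtain w where w: "z = \<phi> i w" using surj[OF i] by (metis surjD)
      have "w \<in> ball x (\<epsilon> / b i)"
        using z b_pos[OF i] by (simp add: w dist_map[OF i] field_simps)
      then have "w \<in> U" using X(1)[OF i] x unfolding config_def by blast
      then show "z \<in> \<phi> i ` U" using w by blast
    qed
    have inU: "\<phi> i x \<in> \<phi> i ` U" if "i \<in> I" "x \<in> X i" for i x
      using ball[OF that] step(1) by (metis centre_in_ball subsetD)
    define Y where "Y = (\<Union>i\<in>I. \<phi> i ` X i)"
    have fin: "finite (X i)" if "i \<in> I" for i using X(1)[OF that] by (simp add: config_def)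
    have sep: "\<epsilon> \<le> dist (\<phi> i x) (\<phi> j y)"
      if i: "i \<in> I" "x \<in> X i" and j: "j \<in> I" "y \<in> X j" and ne: "\<phi> i x \<noteq> \<phi> j y" for i j x y
    proof (cases "i = j")
      case True
      then have "x \<noteq> y" using ne by auto
      then have "\<epsilon> / b i \<le> dist x y" using X(1)[OF i(1)] i(2) j(2) True unfolding config_def by blast
      then show ?thesis using b_pos[OF i(1)] True dist_map[OF i(1)] by (simp add: field_simps)
    next
      case False
      then have "\<phi> j y \<notin> \<phi> i ` U"
        using U(4) i j inU unfolding disjoint_family_on_def by blast
      then have "\<phi> j y \<notin> ball (\<phi> i x) \<epsilon>" using ball[OF i] by blast
      then show ?thesis by simp
    qed
    have near: "\<exists>y\<in>K. dist (\<phi> i x) y \<le> R * \<epsilon>" if i: "i \<in> I" and x: "x \<in> X i" for i x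
    proof -
      obtain y where y: "y \<in> K" "dist x y \<le> R * (\<epsilon> / b i)"
        using X(1)[OF i] x by (auto simp: config_def)
      have "dist (\<phi> i x) (\<phi> i y) \<le> R * \<epsilon>"
        using y(2) b_pos[OF i] dist_map[OF i] by (simp add: field_simps)
      then show ?thesis using map_in_K[OF i y(1)] by blast
    qed
    have "config \<epsilon> Y"
      unfolding config_def
    proof (intro conjI ballI impI)
      show "finite Y" unfolding Y_def using finite_I fin by blast
    next
      fix z assume "z \<in> Y"
      then obtain i x where ix: "i \<in> I" "x \<in> X i" "z = \<phi> i x" by (auto simp: Y_def)
      show "ball z \<epsilon> \<subseteq> U" using ball[OF ix(1,2)] U(3)[OF ix(1)] ix(3) by blast
      show "\<exists>y\<in>K. dist z y \<le> R * \<epsilon>" using near[OF ix(1,2)] ix(3) by simp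
    next
      fix z w assume "z \<in> Y" "w \<in> Y" "z \<noteq> w"
      then show "\<epsilon> \<le> dist z w" using sep by (auto simp: Y_def)
    qed
    have inj: "inj_on (\<phi> i) (X i)" if "i \<in> I" for i
      using dist_map[OF that] b_pos[OF that] by (metis dist_eq_0_iff inj_onI mult_eq_0_iff less_irrefl)
    have "card Y = (\<Sum>i\<in>I. card (\<phi> i ` X i))"
      unfolding Y_def
    proof (rule card_UN_disjoint[OF finite_I])
      show "\<forall>i\<in>I. finite (\<phi> i ` X i)" using fin by blast
      show "\<forall>i\<in>I. \<forall>j\<in>I. i \<noteq> j \<longrightarrow> \<phi> i ` X i \<inter> \<phi> j ` X j = {}"
      proof (intro ballI impI)
        fix i j assume ij: "i \<in> I" "j \<in> I" "i \<noteq> j"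
        have "\<phi> i ` X i \<subseteq> \<phi> i ` U" "\<phi> j ` X j \<subseteq> \<phi> j ` U" using inU ij by auto
        then show "\<phi> i ` X i \<inter> \<phi> j ` X j = {}" using disjoint_family_onD[OF U(4) ij] by blast
      qed
    qed
    also have "\<dots> = (\<Sum>i\<in>I. card (X i))" using inj by (intro sum.cong card_image) auto
    finally have cardY: "real (card Y) = (\<Sum>i\<in>I. real (card (X i)))" by simp
    have "c * (1 * \<epsilon> powr - t) \<le> c * ((\<Sum>i\<in>I. b i powr t) * \<epsilon> powr - t)"
      using t c by (intro mult_left_mono mult_right_mono) auto
    also have "\<dots> = (\<Sum>i\<in>I. c * (\<epsilon> / b i) powr - t)"
      by (simp only: sum_distrib_left[symmetric] powr_sum_scale[OF step(1)])
    also have "\<dots> \<le> real (card Y)" unfolding cardY using X(2) by (rule sum_mono)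
    finally show ?case using \<open>config \<epsilon> Y\<close> by auto
  qed
  show ?thesis
  proof (rule that[OF c \<rho>(1)])
    fix \<epsilon> :: real assume "0 < \<epsilon>" "\<epsilon> \<le> \<rho>"
    then obtain X where X: "config \<epsilon> X" "c * \<epsilon> powr - t \<le> real (card X)" using main by blast
    then show "\<exists>X. finite X \<and> (\<forall>x\<in>X. \<exists>y\<in>K. dist x y \<le> R * \<epsilon>) \<and>
      (\<forall>x\<in>X. \<forall>y\<in>X. x \<noteq> y \<longrightarrow> \<epsilon> \<le> dist x y) \<and> c * \<epsilon> powr - t \<le> real (card X)"
      by (intro exI[of _ X]) (simp add: config_def)
  qed
qed

end

text \<open>Each point of \<open>X\<close> is assigned a nearby point of \<open>K\<close>. Points
  assigned to the same component lie within \<open>(R + C + R) * \<epsilon>\<close> of each other,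
  and packing bounds their number.\<close>

lemma card_separated_near_le:
  fixes K :: "'a::euclidean_space set"
  obtains M :: nat where "\<And>\<epsilon> X. 0 < \<epsilon> \<Longrightarrow> compact K
    \<Longrightarrow> (\<And>x y. x \<in> K \<Longrightarrow> y \<in> chain_component \<epsilon> K x \<Longrightarrow> dist x y \<le> C * \<epsilon>)
    \<Longrightarrow> finite X \<Longrightarrow> (\<And>x. x \<in> X \<Longrightarrow> \<exists>y\<in>K. dist x y \<le> R * \<epsilon>)
    \<Longrightarrow> (\<And>x y. x \<in> X \<Longrightarrow> y \<in> X \<Longrightarrow> x \<noteq> y \<Longrightarrow> \<epsilon> \<le> dist x y)
    \<Longrightarrow> card X \<le> card (chain_components \<epsilon> K) * M"
proof -
  obtain M :: nat where M: "\<And>\<epsilon> X (c::'a). 0 < \<epsilon> \<Longrightarrow> (\<And>x. x \<in> X \<Longrightarrow> dist c x \<le> (R + C + R) * \<epsilon>)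
    \<Longrightarrow> (\<And>x y. x \<in> X \<Longrightarrow> y \<in> X \<Longrightarrow> x \<noteq> y \<Longrightarrow> \<epsilon> \<le> dist x y) \<Longrightarrow> card X \<le> M"
    using packing_bound[of "R + C + R"] by blast
  show ?thesis
  proof
    fix \<epsilon> :: real and X :: "'a set"
    assume \<epsilon>: "0 < \<epsilon>" and K: "compact K"
      and diam: "\<And>x y. x \<in> K \<Longrightarrow> y \<in> chain_component \<epsilon> K x \<Longrightarrow> dist x y \<le> C * \<epsilon>"
      and fin: "finite X" and near: "\<And>x. x \<in> X \<Longrightarrow> \<exists>y\<in>K. dist x y \<le> R * \<epsilon>"
      and sep: "\<And>x y. x \<in> X \<Longrightarrow> y \<in> X \<Longrightarrow> x \<noteq> y \<Longrightarrow> \<epsilon> \<le> dist x y"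
    obtain p where p: "\<And>x. x \<in> X \<Longrightarrow> p x \<in> K \<and> dist x (p x) \<le> R * \<epsilon>"
      using near by metis
    let ?fib = "\<lambda>D. {x \<in> X. chain_component \<epsilon> K (p x) = D}"
    have fib: "card (?fib D) \<le> M" for D
    proof (cases "?fib D = {}")
      case False
      then obtain c where c: "c \<in> ?fib D" by blast
      have "dist c x \<le> (R + C + R) * \<epsilon>" if x: "x \<in> ?fib D" for x
      proof -
        have "p x \<in> chain_component \<epsilon> K (p c)"
          using c x chain_component_refl[of "p x" \<epsilon> K] by simp
        then have "dist (p c) (p x) \<le> C * \<epsilon>" using diam p c by blast
        moreover have "dist c (p c) \<le> R * \<epsilon>" "dist x (p x) \<le> R * \<epsilon>" using p c x by auto
        moreover have "dist c x \<le> dist c (p c) + dist (p c) (p x) + dist x (p x)"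
          using dist_triangle[of c x "p c"] dist_triangle[of "p c" x "p x"]
          by (simp add: dist_commute)
        ultimately show ?thesis by (simp add: algebra_simps)
      qed
      then show ?thesis using sep by (intro M[OF \<epsilon>, of _ c]) auto
    qed (metis card.empty le0)
    have "X = (\<Union>D\<in>chain_components \<epsilon> K. ?fib D)" using p by (auto simp: chain_components_def)
    then have "card X \<le> (\<Sum>D\<in>chain_components \<epsilon> K. card (?fib D))"
      using card_UN_le[OF finite_chain_components[OF K \<epsilon>], of ?fib] by simp
    also have "\<dots> \<le> card (chain_components \<epsilon> K) * M"
      using fib sum_bounded_above[of "chain_components \<epsilon> K" "\<lambda>D. card (?fib D)" M] by simp
    finally show "card X \<le> card (chain_components \<epsilon> K) * M" .
  qed
qed

text \<open>If \<open>t > s\<close>, the hypothesis keeps \<open>A * \<epsilon> powr (t - s)\<close>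
  at least \<open>c\<close>, although it tends to 0 with \<open>\<epsilon>\<close>.\<close>

lemma powr_bound_exponent_le:
  assumes "0 < c" "0 < \<rho>" "0 \<le> A"
    and "\<And>\<epsilon>. 0 < \<epsilon> \<Longrightarrow> \<epsilon> \<le> \<rho> \<Longrightarrow> c * \<epsilon> powr - t \<le> A * \<epsilon> powr - s"
  shows "t \<le> (s::real)"
proof (rule ccontr)
  assume "\<not> t \<le> s"
  then have ts: "0 < t - s" by simp
  \<comment> \<open>This gives \<open>\<epsilon> powr (t - s) \<le> c / (A + 1)\<close>; the
    denominator \<open>A + 1\<close> also covers \<open>A = 0\<close>.\<close>
  define \<epsilon> where "\<epsilon> = min \<rho> ((c / (A + 1)) powr (1 / (t - s)))"
  have cA: "0 < c / (A + 1)" using assms by simp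
  then have \<epsilon>: "0 < \<epsilon>" "\<epsilon> \<le> \<rho>" using assms(1-3) unfolding \<epsilon>_def by auto
  have "\<epsilon> powr (t - s) \<le> ((c / (A + 1)) powr (1 / (t - s))) powr (t - s)"
    using ts \<epsilon>(1) by (intro powr_mono2) (auto simp: \<epsilon>_def)
  also have "\<dots> = c / (A + 1)" using ts assms(1,3) by (simp add: powr_powr)
  finally have "A * \<epsilon> powr (t - s) \<le> A * (c / (A + 1))" using assms(3) by (rule mult_left_mono)
  also have "\<dots> < c" using assms(1,3) by (simp add: field_simps)
  finally have "A * \<epsilon> powr (t - s) < c" .
  moreover have "c * \<epsilon> powr - t * \<epsilon> powr t \<le> A * \<epsilon> powr - s * \<epsilon> powr t"
    using assms(4)[OF \<epsilon>] by (intro mult_right_mono) auto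
  then have "c \<le> A * \<epsilon> powr (t - s)"
    using \<epsilon>(1) by (simp add: mult.assoc flip: powr_add)
  ultimately show False by simp
qed

section \<open>Separation conditions\<close>

lemma contracting_similitude_surj:
  assumes "contracting_similitude f"
  shows "surj f"
proof -
  obtain a T t where a: "0 < a" and T: "orthogonal_transformation T"
    and f: "f = (\<lambda>x. a *\<^sub>R T x + t)"
    using assms unfolding contracting_similitude_def by blast
  have "\<exists>x. y = f x" for y
  proof -
    obtain x where "T x = (1 / a) *\<^sub>R (y - t)"
      using orthogonal_transformation_surj[OF T] by (metis surjD)
    then show ?thesis using a by (intro exI[of _ x]) (simp add: f)
  qed
  then show ?thesis by (simp add: surj_def)
qed

lemma generating_ifs_system:
  assumes "generating_ifs I \<phi> K"
  obtains a where "self_similar_system I a \<phi> K"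
proof -
  have \<phi>: "finite I" "2 \<le> card I" "\<And>i. i \<in> I \<Longrightarrow> contracting_similitude (\<phi> i)"
    and K: "K \<noteq> {}" "compact K" "K = (\<Union>i\<in>I. \<phi> i ` K)"
    using assms unfolding generating_ifs_def ifs_def is_attractor_def by auto
  have "\<exists>a. 0 < a \<and> a < 1 \<and> (\<forall>x y. dist (\<phi> i x) (\<phi> i y) = a * dist x y)" if "i \<in> I" for i
    using contracting_similitude_dist[OF \<phi>(3)[OF that]] by metis
  then obtain a where a: "\<And>i. i \<in> I \<Longrightarrow> 0 < a i \<and> a i < 1 \<and> (\<forall>x y. dist (\<phi> i x) (\<phi> i y) = a i * dist x y)"
    by metis
  have "self_similar_system I a \<phi> K"
    by unfold_locales (use \<phi> a K in auto)
  then show ?thesis by (rule that)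
qed

lemma osc_imp_ssc:
  assumes \<psi>: "generating_ifs J \<psi> K" "ssc J \<psi>" and \<phi>: "generating_ifs I \<phi> K" "osc I \<phi>"
  shows "ssc I \<phi>"
proof -
  obtain a where a: "self_similar_system I a \<phi> K" using generating_ifs_system[OF \<phi>(1)] .
  obtain b where b: "self_similar_system J b \<psi> K" using generating_ifs_system[OF \<psi>(1)] .
  interpret \<Phi>: self_similar_system I a \<phi> K by (rule a)
  interpret \<Psi>: self_similar_system J b \<psi> K by (rule b)
  define N where "N \<epsilon> = real (card (chain_components \<epsilon> K))" for \<epsilon>
  have "disjoint_family_on (\<lambda>j. \<psi> j ` K) J"
    using \<psi> attractor_eq unfolding ssc_def by metis
  then obtain \<delta> C where \<delta>: "0 < \<delta>"
    and card: "\<And>\<epsilon>. 0 < \<epsilon> \<Longrightarrow> \<epsilon> < \<delta> \<Longrightarrow> card (chain_components \<epsilon> K) = (\<Sum>j\<in>J. card (chain_components (\<epsilon> / b j) K))"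
    and diam: "\<And>\<epsilon> x y. 0 < \<epsilon> \<Longrightarrow> x \<in> K \<Longrightarrow> y \<in> chain_component \<epsilon> K x \<Longrightarrow> dist x y \<le> C * \<epsilon>"
    by (rule \<Psi>.components_separated) (rule that)
  have N: "N \<epsilon> = (\<Sum>j\<in>J. N (\<epsilon> / b j))" if "0 < \<epsilon>" "\<epsilon> < \<delta>" for \<epsilon>
    unfolding N_def using card[OF that] by simp
  have "2 \<le> card J" using \<psi>(1) by (simp add: generating_ifs_def ifs_def)
  then obtain s where s: "0 < s" "(\<Sum>j\<in>J. b j powr s) = 1" by (rule \<Psi>.similarity_dimension)
  obtain n where n: "\<And>\<epsilon>. \<delta> \<le> \<epsilon> \<Longrightarrow> finite (chain_components \<epsilon> K) \<and> card (chain_components \<epsilon> K) \<le> n"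
    using chain_components_bounded[OF \<Phi>.compact_K \<delta>] by blast
  obtain A where A: "0 \<le> A" "\<And>\<epsilon>. 0 < \<epsilon> \<Longrightarrow> \<epsilon> < \<delta> \<Longrightarrow> N \<epsilon> \<le> A * \<epsilon> powr - s"
  proof (rule \<Psi>.scale_upper[of s \<delta> "real n" N])
    show "N \<epsilon> \<le> real n" if "\<delta> \<le> \<epsilon>" for \<epsilon> using n[OF that] by (simp add: N_def)
  qed (use s \<delta> N in auto)
  \<comment> \<open>Otherwise the OSC would produce, for some \<open>t > s\<close>, at least of
    order \<open>\<epsilon> powr - t\<close> separated points near \<open>K\<close>, while their
    number is at most a multiple of \<open>N \<epsilon>\<close>, hence of
    \<open>\<epsilon> powr - s\<close>.\<close>
  have dimension: "(\<Sum>i\<in>I. a i powr s) \<le> 1"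
  proof (rule ccontr)
    assume "\<not> ?thesis"
    then obtain t where t: "s < t" "1 \<le> (\<Sum>i\<in>I. a i powr t)"
      using \<Phi>.similarity_dimension_greater[of s] by auto
    then have "0 \<le> t" using s(1) by simp
    obtain U where U: "open U" "U \<noteq> {}" "\<And>i. i \<in> I \<Longrightarrow> \<phi> i ` U \<subseteq> U"
      "disjoint_family_on (\<lambda>i. \<phi> i ` U) I"
      using \<phi>(2) unfolding osc_def by blast
    have surj: "surj (\<phi> i)" if "i \<in> I" for i
      using \<phi>(1) that contracting_similitude_surj by (auto simp: generating_ifs_def ifs_def)
    obtain R c \<rho> where c: "0 < c" and \<rho>: "0 < \<rho>"
      and X: "\<And>\<epsilon>. 0 < \<epsilon> \<Longrightarrow> \<epsilon> \<le> \<rho> \<Longrightarrow> \<exists>X. finite X \<and> (\<forall>x\<in>X. \<exists>y\<in>K. dist x y \<le> R * \<epsilon>) \<and>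
        (\<forall>x\<in>X. \<forall>y\<in>X. x \<noteq> y \<longrightarrow> \<epsilon> \<le> dist x y) \<and> c * \<epsilon> powr - t \<le> real (card X)"
      by (rule \<Phi>.separated_configurations[OF U surj \<open>0 \<le> t\<close> t(2)]) (assumption | rule that)+
    obtain M :: nat where M: "\<And>\<epsilon> X. 0 < \<epsilon> \<Longrightarrow> compact K
      \<Longrightarrow> (\<And>x y. x \<in> K \<Longrightarrow> y \<in> chain_component \<epsilon> K x \<Longrightarrow> dist x y \<le> C * \<epsilon>)
      \<Longrightarrow> finite X \<Longrightarrow> (\<And>x. x \<in> X \<Longrightarrow> \<exists>y\<in>K. dist x y \<le> R * \<epsilon>)
      \<Longrightarrow> (\<And>x y. x \<in> X \<Longrightarrow> y \<in> X \<Longrightarrow> x \<noteq> y \<Longrightarrow> \<epsilon> \<le> dist x y)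
      \<Longrightarrow> card X \<le> card (chain_components \<epsilon> K) * M"
      using card_separated_near_le[of K C R] by blast
    have "t \<le> s"
    proof (rule powr_bound_exponent_le[OF c])
      \<comment> \<open>Halving \<open>\<delta>\<close> turns the non-strict bound on
        \<open>\<epsilon>\<close> into the strict \<open>\<epsilon> < \<delta>\<close> that the
        bound on \<open>N\<close> asks for.\<close>
      show "0 < min \<rho> (\<delta> / 2)" "0 \<le> A * real M" using \<rho> \<delta> A(1) by auto
      fix \<epsilon> :: real assume \<epsilon>: "0 < \<epsilon>" "\<epsilon> \<le> min \<rho> (\<delta> / 2)"
      obtain X where X: "finite X" "\<forall>x\<in>X. \<exists>y\<in>K. dist x y \<le> R * \<epsilon>"
        "\<forall>x\<in>X. \<forall>y\<in>X. x \<noteq> y \<longrightarrow> \<epsilon> \<le> dist x y" "c * \<epsilon> powr - t \<le> real (card X)"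
        using X[of \<epsilon>] \<epsilon> by auto
      have "card X \<le> card (chain_components \<epsilon> K) * M"
        using \<epsilon>(1) \<Phi>.compact_K diam X(1-3) by (intro M) auto
      then have "real (card X) \<le> N \<epsilon> * real M"
        unfolding N_def by (metis of_nat_le_iff of_nat_mult)
      also have "\<dots> \<le> A * \<epsilon> powr - s * real M"
        using A(2)[OF \<epsilon>(1)] \<epsilon>(2) \<delta> by (intro mult_right_mono) auto
      finally show "c * \<epsilon> powr - t \<le> A * real M * \<epsilon> powr - s" using X(4) by (simp add: mult_ac)
    qed
    then show False using t(1) by simp
  qed
  have "\<phi> i ` K \<inter> \<phi> j ` K = {}" if ij: "i \<in> I" "j \<in> I" "i \<noteq> j" for i j
  proof (rule ccontr)
    assume "\<phi> i ` K \<inter> \<phi> j ` K \<noteq> {}"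
    then have overlap: "N \<epsilon> + 1 \<le> (\<Sum>i\<in>I. N (\<epsilon> / a i))" if "0 < \<epsilon>" for \<epsilon>
      using \<Phi>.components_overlap[OF ij _ that] unfolding N_def
      by (metis of_nat_1 of_nat_add of_nat_le_iff of_nat_sum)
    define F where "F \<epsilon> = (\<Sum>i\<in>I. N (\<epsilon> / a i)) - N \<epsilon>" for \<epsilon>
    obtain lo where lo: "0 < lo" "lo < 1" "\<And>i. i \<in> I \<Longrightarrow> lo \<le> a i" using \<Phi>.lower_bound by blast
    \<comment> \<open>Below \<open>lo * \<delta>\<close> all scales \<open>\<epsilon> / a i\<close>
      are below \<open>\<delta>\<close>, so the renewal equation applies to every term of
      \<open>F\<close>; interchanging the sums gives the one for \<open>F\<close>.\<close>
    have F: "F \<epsilon> = (\<Sum>j\<in>J. F (\<epsilon> / b j))" if \<epsilon>: "0 < \<epsilon>" "\<epsilon> < lo * \<delta>" for \<epsilon>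
    proof -
      have "lo * \<delta> \<le> \<delta>" using lo \<delta> by simp
      then have "\<epsilon> < \<delta>" using \<epsilon>(2) by simp
      have "N (\<epsilon> / a i) = (\<Sum>j\<in>J. N (\<epsilon> / b j / a i))" if i: "i \<in> I" for i
      proof -
        have "\<epsilon> / a i \<le> \<epsilon> / lo" using lo(1) lo(3)[OF i] \<epsilon>(1) by (intro frac_le) auto
        also have "\<dots> < \<delta>" using \<epsilon>(2) lo(1) by (simp add: field_simps)
        finally show ?thesis
          using N[of "\<epsilon> / a i"] \<epsilon>(1) \<Phi>.b_pos[OF i] by (simp add: mult.commute)
      qed
      then have "F \<epsilon> = (\<Sum>i\<in>I. \<Sum>j\<in>J. N (\<epsilon> / b j / a i)) - (\<Sum>j\<in>J. N (\<epsilon> / b j))"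
        using N[OF \<epsilon>(1) \<open>\<epsilon> < \<delta>\<close>] by (simp add: F_def)
      then show ?thesis
        unfolding F_def by (subst (asm) sum.swap) (simp add: sum_subtractf)
    qed
    have lower: "(lo * \<delta>) powr s * \<epsilon> powr - s \<le> F \<epsilon>" if \<epsilon>: "0 < \<epsilon>" for \<epsilon>
    proof (rule \<Psi>.scale_lower[of s "lo * \<delta>" F])
      show "1 \<le> F \<epsilon>" if "lo * \<delta> \<le> \<epsilon>" for \<epsilon>
      proof -
        have "0 < lo * \<delta>" using lo \<delta> by simp
        then show ?thesis using overlap[of \<epsilon>] that unfolding F_def by linarith
      qed
    qed (use s lo \<delta> F \<epsilon> in auto)
    \<comment> \<open>At every scale the defect is now at least a fixed multiple of
      \<open>\<epsilon> powr - s\<close>.\<close>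
    show False
    proof (rule \<Phi>.no_uniform_defect[OF dimension \<delta>, of "(lo * \<delta>) powr s" N A])
      show "0 < (lo * \<delta>) powr s" using lo \<delta> by simp
      show "N \<epsilon> + (lo * \<delta>) powr s * \<epsilon> powr - s \<le> (\<Sum>i\<in>I. N (\<epsilon> / a i))" if "0 < \<epsilon>" for \<epsilon>
        using lower[OF that] by (simp add: F_def)
    qed (use A in \<open>auto simp: N_def\<close>)
  qed
  then show ?thesis
    unfolding ssc_def attractor_eq[OF \<phi>(1)] disjoint_family_on_def by blast
qed

section \<open>Elementary properties of similitudes and consequences of the SSC\<close>

lemma contracting_similitude_continuous:
  assumes "contracting_similitude f"
  shows "continuous_on S f"
proof -
  obtain a where a: "0 < a" "\<And>x y. dist (f x) (f y) = a * dist x y"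
    using contracting_similitude_dist[OF assms] by metis
  then have "a-lipschitz_on S f" by (intro lipschitz_onI) auto
  then show ?thesis by (rule lipschitz_on_continuous_on)
qed

lemma contracting_similitude_comp:
  assumes "contracting_similitude f" "contracting_similitude g"
  shows "contracting_similitude (f \<circ> g)"
proof -
  obtain a T t where f: "0 < a" "a < 1" "orthogonal_transformation T" "f = (\<lambda>x. a *\<^sub>R T x + t)"
    using assms(1) unfolding contracting_similitude_def by blast
  obtain b S u where g: "0 < b" "b < 1" "orthogonal_transformation S" "g = (\<lambda>x. b *\<^sub>R S x + u)"
    using assms(2) unfolding contracting_similitude_def by blast
  have "f \<circ> g = (\<lambda>x. (a * b) *\<^sub>R (T \<circ> S) x + f u)"
    using orthogonal_transformation_linear[OF f(3)]
    by (auto simp: f(4) g(4) linear_add linear_scale scaleR_add_right add.assoc)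
  moreover have "a * b < 1 * 1" using f g by (intro mult_strict_mono) auto
  ultimately show ?thesis
    unfolding contracting_similitude_def
    using f(1,3) g(1,3) orthogonal_transformation_compose[OF f(3) g(3)] by (metis mult_1 mult_pos_pos)
qed

text \<open>\<open>h\<close> multiplies the diameter by \<open>a < 1\<close>, so equality would
  force diameter 0, that is, a single point.\<close>

lemma contracting_similitude_image_neq:
  assumes h: "contracting_similitude h" and K: "compact K" "K \<noteq> {}" "\<not> is_singleton K"
  shows "h ` K \<noteq> K"
proof
  assume eq: "h ` K = K"
  obtain a where a: "0 < a" "a < 1" "\<And>x y. dist (h x) (h y) = a * dist x y"
    using contracting_similitude_dist[OF h] by metis
  obtain x y where xy: "x \<in> K" "y \<in> K" "dist x y = diameter K"
    using diameter_compact_attained[OF K(1,2)] by blast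
  have "x \<in> h ` K" "y \<in> h ` K" using xy(1,2) by (simp_all add: eq)
  then obtain u v where uv: "u \<in> K" "v \<in> K" "x = h u" "y = h v" by (elim imageE)
  have le: "dist p q \<le> diameter K" if "p \<in> K" "q \<in> K" for p q
    using K(1) that by (intro diameter_bounded_bound compact_imp_bounded)
  have "diameter K = a * dist u v" unfolding xy(3)[symmetric] uv(3,4) by (rule a(3))
  also have "\<dots> \<le> a * diameter K" using le[OF uv(1,2)] a(1) by (intro mult_left_mono) auto
  finally have "(1 - a) * diameter K \<le> 0" by (simp add: algebra_simps)
  then have "diameter K \<le> 0" using a(2) by (simp add: mult_le_0_iff)
  then have "dist p q \<le> 0" if "p \<in> K" "q \<in> K" for p q
    using le[OF that] by linarith
  then have "p = q" if "p \<in> K" "q \<in> K" for p q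
    using that by simp
  then have "K = {x}" using xy(1) by blast
  then show False using K(3) unfolding is_singleton_def by blast
qed

lemma ssc_disjoint:
  assumes "generating_ifs I \<phi> K" "ssc I \<phi>"
  shows "disjoint_family_on (\<lambda>i. \<phi> i ` K) I"
  using assms attractor_eq unfolding ssc_def by metis

text \<open>With \<open>\<delta>\<close> the gap between the pieces, the open
  \<open>\<delta> / 2\<close>-neighbourhood of \<open>K\<close> serves as \<open>U\<close>: the
  contractions map it into the \<open>\<delta> / 2\<close>-neighbourhoods of the pieces, which are
  disjoint.\<close>

lemma ssc_imp_osc:
  assumes "generating_ifs I \<phi> K" "ssc I \<phi>"
  shows "osc I \<phi>"
proof -
  obtain a where "self_similar_system I a \<phi> K" using generating_ifs_system[OF assms(1)] .
  then interpret self_similar_system I a \<phi> K .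
  obtain \<delta> where \<delta>: "0 < \<delta>" and sep: "\<And>i j x y. i \<in> I \<Longrightarrow> j \<in> I \<Longrightarrow> i \<noteq> j \<Longrightarrow>
      x \<in> \<phi> i ` K \<Longrightarrow> y \<in> \<phi> j ` K \<Longrightarrow> \<delta> \<le> dist x y"
    using compact_family_gap[of I "\<lambda>i. \<phi> i ` K", OF finite_I compact_image_K ssc_disjoint[OF assms]]
    by metis
  define U where "U = (\<Union>y\<in>K. ball y (\<delta> / 2))"
  have near: "\<exists>y\<in>K. dist (\<phi> i y) (\<phi> i x) < \<delta> / 2" if i: "i \<in> I" and x: "x \<in> U" for i x
  proof -
    obtain y where y: "y \<in> K" "dist y x < \<delta> / 2" using x by (auto simp: U_def)
    have "a i * dist y x \<le> 1 * dist y x" using b_less_1[OF i] by (intro mult_right_mono) auto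
    then show ?thesis using y dist_map[OF i] by (intro bexI[of _ y]) auto
  qed
  have "open U" unfolding U_def by blast
  moreover have "U \<noteq> {}" using K_nonempty \<delta> by (auto simp: U_def)
  moreover have "\<phi> i ` U \<subseteq> U" if i: "i \<in> I" for i
  proof (rule image_subsetI)
    fix x assume "x \<in> U"
    then obtain y where "y \<in> K" "dist (\<phi> i y) (\<phi> i x) < \<delta> / 2" using near[OF i] by blast
    then show "\<phi> i x \<in> U" unfolding U_def using map_in_K[OF i] by auto
  qed
  moreover have "disjoint_family_on (\<lambda>i. \<phi> i ` U) I"
    unfolding disjoint_family_on_def
  proof (intro ballI impI, rule ccontr)
    fix i j assume ij: "i \<in> I" "j \<in> I" "i \<noteq> j" and "\<phi> i ` U \<inter> \<phi> j ` U \<noteq> {}"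
    then obtain x y where xy: "x \<in> U" "y \<in> U" "\<phi> i x = \<phi> j y" by blast
    obtain u v where uv: "u \<in> K" "v \<in> K" "dist (\<phi> i u) (\<phi> i x) < \<delta> / 2" "dist (\<phi> j v) (\<phi> j y) < \<delta> / 2"
      using near[OF ij(1) xy(1)] near[OF ij(2) xy(2)] by blast
    then have "dist (\<phi> i u) (\<phi> j v) < \<delta>"
      using xy(3) by (metis dist_commute dist_triangle_half_l)
    moreover have "\<delta> \<le> dist (\<phi> i u) (\<phi> j v)" using ij uv by (intro sep) auto
    ultimately show False by simp
  qed
  ultimately show ?thesis unfolding osc_def by blast
qed

text \<open>The other pieces form a closed set \<open>L\<close>, a finite union of compact sets, and
  the SSC makes the given piece equal to \<open>K - L\<close>.\<close>

lemma ssc_imp_openin: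
  assumes "generating_ifs I \<phi> K" "ssc I \<phi>" "i \<in> I"
  shows "openin (top_of_set K) (\<phi> i ` K)"
proof -
  obtain a where "self_similar_system I a \<phi> K" using generating_ifs_system[OF assms(1)] .
  then interpret self_similar_system I a \<phi> K .
  define L where "L = (\<Union>j\<in>I - {i}. \<phi> j ` K)"
  have "closed L"
    unfolding L_def using finite_I compact_image_K by (intro closed_UN) (auto intro: compact_imp_closed)
  have "\<phi> i ` K \<inter> L = {}"
    unfolding L_def using disjoint_family_onD[OF ssc_disjoint[OF assms(1,2)] assms(3)] by fastforce
  moreover have "K = \<phi> i ` K \<union> L" using K_eq assms(3) unfolding L_def by blast
  ultimately have "\<phi> i ` K = K - L" by blast
  moreover have "openin (top_of_set K) (K \<inter> - L)"
    using \<open>closed L\<close> by (intro openin_open_Int) auto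
  ultimately show ?thesis by (simp add: Diff_eq)
qed

section \<open>Words\<close>

lemma word_map_Nil [simp]: "word_map \<psi> [] = id"
  by (simp add: word_map_def)

lemma word_map_Cons [simp]: "word_map \<psi> (j # js) = \<psi> j \<circ> word_map \<psi> js"
  by (simp add: word_map_def)

text \<open>The empty word is excluded because it gives the identity, which does not
  contract.\<close>

lemma contracting_similitude_word_map:
  assumes "\<And>i. i \<in> I \<Longrightarrow> contracting_similitude (\<psi> i)" "set js \<subseteq> I" "js \<noteq> []"
  shows "contracting_similitude (word_map \<psi> js)"
  using assms(2,3)
proof (induction js)
  case (Cons j js)
  show ?case
  proof (cases "js = []")
    case True
    then show ?thesis using Cons.prems assms(1) by simp
  next
    case False
    then show ?thesis
      using Cons assms(1) by (simp del: comp_apply add: contracting_similitude_comp)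
  qed
qed simp

lemma word_cylinders_cover:
  assumes "K = (\<Union>i\<in>I. \<psi> i ` K)"
  shows "K = (\<Union>js\<in>{js. length js = l \<and> set js \<subseteq> I}. word_map \<psi> js ` K)"
proof (induction l)
  case 0
  have "{js. length js = 0 \<and> set js \<subseteq> I} = {[]}" by auto
  then show ?case by simp
next
  case (Suc l)
  let ?W = "\<lambda>l. {js. length js = l \<and> set js \<subseteq> I}"
  have "(\<Union>js\<in>?W (Suc l). word_map \<psi> js ` K) = (\<Union>i\<in>I. \<psi> i ` (\<Union>js\<in>?W l. word_map \<psi> js ` K))"
    (is "?A = ?B")
  proof
    show "?A \<subseteq> ?B"
    proof
      fix x assume "x \<in> ?A"
      then obtain js y where js: "length js = Suc l" "set js \<subseteq> I" "y \<in> K" "x = word_map \<psi> js y" by blast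
      then obtain i w where "js = i # w" by (cases js) auto
      then show "x \<in> ?B" using js by auto
    qed
    show "?B \<subseteq> ?A"
    proof
      fix x assume "x \<in> ?B"
      then obtain i js y where "i \<in> I" "length js = l" "set js \<subseteq> I" "y \<in> K" "x = \<psi> i (word_map \<psi> js y)"
        by blast
      then have "i # js \<in> ?W (Suc l)" "x = word_map \<psi> (i # js) y" by auto
      then show "x \<in> ?A" using \<open>y \<in> K\<close> by blast
    qed
  qed
  then show ?case using Suc.IH assms by simp
qed

lemma word_cylinder_subset:
  assumes "K = (\<Union>i\<in>I. \<psi> i ` K)" "set js \<subseteq> I"
  shows "word_map \<psi> js ` K \<subseteq> K"
  using word_cylinders_cover[OF assms(1), of "length js"] assms(2) by blast

text \<open>If two cylinders of equal length meet, their first letters agree because the pieces are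
  disjoint; injectivity strips this letter off, and induction does the rest.\<close>

lemma word_cylinders_disjoint:
  assumes K: "K = (\<Union>i\<in>I. \<psi> i ` K)" and disj: "disjoint_family_on (\<lambda>i. \<psi> i ` K) I"
    and inj: "\<And>i. i \<in> I \<Longrightarrow> inj (\<psi> i)"
  shows "disjoint_family_on (\<lambda>js. word_map \<psi> js ` K) {js. length js = l \<and> set js \<subseteq> I}"
proof -
  \<comment> \<open>A formulation by points suits the induction: \<open>x\<close> and
    \<open>y\<close> stay the same when the first letters are removed.\<close>
  have "js = ks" if "length js = l" "length ks = l" "set js \<subseteq> I" "set ks \<subseteq> I"
    "x \<in> K" "y \<in> K" "word_map \<psi> js x = word_map \<psi> ks y" for js ks x y
    using that
  proof (induction l arbitrary: js ks)
    case (Suc l)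
    obtain i u where js: "js = i # u" using Suc.prems(1) by (cases js) auto
    obtain j v where ks: "ks = j # v" using Suc.prems(2) by (cases ks) auto
    have ij: "i \<in> I" "j \<in> I" and uv: "set u \<subseteq> I" "set v \<subseteq> I" using Suc.prems js ks by auto
    have mem: "word_map \<psi> u x \<in> K" "word_map \<psi> v y \<in> K"
      using word_cylinder_subset[OF K] uv Suc.prems(5,6) by blast+
    have eq: "\<psi> i (word_map \<psi> u x) = \<psi> j (word_map \<psi> v y)" using Suc.prems(7) js ks by simp
    have "i = j"
    proof (rule ccontr)
      assume "i \<noteq> j"
      then have "\<psi> i ` K \<inter> \<psi> j ` K = {}" using disjoint_family_onD[OF disj ij] by blast
      then show False using mem eq by (metis IntI empty_iff imageI)
    qed
    then have "word_map \<psi> u x = word_map \<psi> v y" using inj[OF ij(1)] eq by (simp add: inj_eq)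
    then have "u = v" using Suc js ks uv by simp
    then show ?case using \<open>i = j\<close> js ks by simp
  qed simp
  then show ?thesis unfolding disjoint_family_on_def by blast
qed

text \<open>Each letter contracts at least by the factor \<open>hi\<close>, so the diameters of
  cylinders decay geometrically, uniformly over all words of a given length.\<close>

lemma (in self_similar_system) small_word_cylinders:
  assumes "0 < \<delta>"
  obtains l where "1 \<le> l" "\<And>js x y. length js = l \<Longrightarrow> set js \<subseteq> I \<Longrightarrow> x \<in> K \<Longrightarrow> y \<in> K \<Longrightarrow>
    dist (word_map \<phi> js x) (word_map \<phi> js y) < \<delta>"
proof -
  obtain hi where hi: "0 < hi" "hi < 1" "\<And>i. i \<in> I \<Longrightarrow> b i \<le> hi" using upper_bound by blast
  have le: "dist (word_map \<phi> js x) (word_map \<phi> js y) \<le> hi ^ length js * dist x y"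
    if "set js \<subseteq> I" for js x y
    using that
  proof (induction js)
    case (Cons j js)
    then have j: "j \<in> I" and "set js \<subseteq> I" by auto
    have "dist (word_map \<phi> (j # js) x) (word_map \<phi> (j # js) y) =
        b j * dist (word_map \<phi> js x) (word_map \<phi> js y)"
      using dist_map[OF j] by simp
    also have "\<dots> \<le> hi * (hi ^ length js * dist x y)"
      using hi(3)[OF j] hi(1) Cons.IH[OF \<open>set js \<subseteq> I\<close>] by (intro mult_mono) auto
    finally show ?case by simp
  qed simp
  \<comment> \<open>The added 1 keeps the divisor \<open>D\<close> positive even if the diameter is
    0.\<close>
  define D where "D = diameter K + 1"
  have "0 \<le> diameter K" using compact_K by (simp add: diameter_ge_0 compact_imp_bounded)
  then have D: "0 < D" by (simp add: D_def)
  obtain k where k: "hi ^ k < \<delta> / D"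
    using real_arch_pow_inv[OF _ hi(2), of "\<delta> / D"] D assms by auto
  \<comment> \<open>The length \<open>Suc k\<close> instead of \<open>k\<close> guarantees
    \<open>1 \<le> l\<close>.\<close>
  show ?thesis
  proof (rule that[of "Suc k"])
    fix js x y assume js: "length js = Suc k" "set js \<subseteq> I" and xy: "x \<in> K" "y \<in> K"
    have "dist x y \<le> D"
      using diameter_bounded_bound[OF compact_imp_bounded[OF compact_K] xy] by (simp add: D_def)
    then have "dist (word_map \<phi> js x) (word_map \<phi> js y) \<le> hi ^ Suc k * D"
      using le[OF js(2), of x y] hi(1) js(1) by (metis mult_left_mono order_trans zero_le_power less_imp_le)
    also have "\<dots> \<le> hi ^ k * D"
      using hi D by (intro mult_right_mono power_decreasing) auto
    also have "\<dots> < \<delta>" using k D by (simp add: field_simps)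
    finally show "dist (word_map \<phi> js x) (word_map \<phi> js y) < \<delta>" .
  qed simp
qed

section \<open>Systems formed by \<open>h\<close> and cylinders\<close>

lemma openin_imp_word_ifs:
  fixes K :: "(real ^ 'd) set"
  assumes sing: "\<not> is_singleton K" and h: "contracting_similitude h" "h ` K \<subseteq> K"
    and op: "openin (top_of_set K) (h ` K)" and \<psi>: "generating_ifs I \<psi> K" "ssc I \<psi>"
  obtains l J where "1 \<le> l" "J \<subseteq> {js. length js = l \<and> set js \<subseteq> I}"
    "generating_ifs ({h} \<union> word_map \<psi> ` J) (\<lambda>f. f) K" "ssc ({h} \<union> word_map \<psi> ` J) (\<lambda>f. f)"
proof -
  obtain a where "self_similar_system I a \<psi> K" using generating_ifs_system[OF \<psi>(1)] .
  then interpret self_similar_system I a \<psi> K .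
  have sim: "\<And>i. i \<in> I \<Longrightarrow> contracting_similitude (\<psi> i)"
    using \<psi>(1) by (simp add: generating_ifs_def ifs_def)
  have inj: "inj (\<psi> i)" if "i \<in> I" for i
    using dist_map[OF that] b_pos[OF that] by (metis dist_eq_0_iff injI mult_eq_0_iff less_irrefl)
  have comp_h: "compact (h ` K)"
    using contracting_similitude_continuous[OF h(1)] compact_K by (rule compact_continuous_image)
  \<comment> \<open>Openness in \<open>K\<close> makes the rest of \<open>K\<close> closed, hence at
    a positive distance from the compact image of \<open>h\<close>.\<close>
  obtain T where "open T" "h ` K = K \<inter> T" using op by (auto simp: openin_open)
  then have "K - h ` K = K \<inter> - T" by blast
  then have "closed (K - h ` K)"
    using \<open>open T\<close> compact_imp_closed[OF compact_K] by (simp add: closed_Int closed_Compl)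
  then obtain \<delta> where \<delta>: "0 < \<delta>" "\<And>x y. x \<in> h ` K \<Longrightarrow> y \<in> K - h ` K \<Longrightarrow> \<delta> \<le> dist x y"
    using separate_compact_closed[OF comp_h] by (metis Diff_disjoint)
  obtain l where l: "1 \<le> l" "\<And>js x y. length js = l \<Longrightarrow> set js \<subseteq> I \<Longrightarrow> x \<in> K \<Longrightarrow> y \<in> K \<Longrightarrow>
    dist (word_map \<psi> js x) (word_map \<psi> js y) < \<delta>"
    using small_word_cylinders[OF \<delta>(1)] by blast
  define W where "W = {js. length js = l \<and> set js \<subseteq> I}"
  \<comment> \<open>A cylinder outside \<open>J\<close> meets the image of \<open>h\<close>; its
    points are less than \<open>\<delta>\<close> apart, so it lies in that image entirely.\<close>
  define J where "J = {js \<in> W. word_map \<psi> js ` K \<inter> h ` K = {}}"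
  let ?S = "{h} \<union> word_map \<psi> ` J"
  have cover: "K = (\<Union>js\<in>W. word_map \<psi> js ` K)" unfolding W_def using K_eq by (rule word_cylinders_cover)
  have disjW: "disjoint_family_on (\<lambda>js. word_map \<psi> js ` K) W"
    unfolding W_def using K_eq ssc_disjoint[OF \<psi>] inj by (rule word_cylinders_disjoint)
  have K: "K = h ` K \<union> (\<Union>js\<in>J. word_map \<psi> js ` K)"
  proof
    show "K \<subseteq> h ` K \<union> (\<Union>js\<in>J. word_map \<psi> js ` K)"
    proof
      fix x assume x: "x \<in> K"
      then obtain js u where js: "js \<in> W" "u \<in> K" "x = word_map \<psi> js u" using cover by blast
      show "x \<in> h ` K \<union> (\<Union>js\<in>J. word_map \<psi> js ` K)"
      proof (cases "js \<in> J")
        case True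
        then show ?thesis using js by blast
      next
        case False
        then obtain v where v: "v \<in> K" "word_map \<psi> js v \<in> h ` K" using js(1) by (auto simp: J_def)
        have "dist (word_map \<psi> js v) x < \<delta>" using l(2)[of js v u] js v(1) by (simp add: W_def)
        then have "x \<in> h ` K" using \<delta>(2)[OF v(2), of x] x by fastforce
        then show ?thesis by blast
      qed
    qed
    show "h ` K \<union> (\<Union>js\<in>J. word_map \<psi> js ` K) \<subseteq> K" using h(2) cover by (auto simp: J_def)
  qed
  \<comment> \<open>Otherwise \<open>h\<close> would map \<open>K\<close> onto itself, which a
    contraction cannot do when \<open>K\<close> has more than one point.\<close>
  have "J \<noteq> {}"
  proof
    assume "J = {}"
    then have "h ` K = K" using K by simp
    then show False using contracting_similitude_image_neq[OF h(1) compact_K K_nonempty sing] by blast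
  qed
  then obtain js where js: "js \<in> J" by blast
  have "finite W" unfolding W_def using finite_lists_length_eq[OF finite_I, of l] by (simp add: conj_commute)
  then have finS: "finite ?S" by (simp add: J_def)
  \<comment> \<open>Disjoint nonempty images make the maps distinct, which secures the two maps that
    an IFS must have.\<close>
  have "word_map \<psi> js \<noteq> h" using js K_nonempty by (auto simp: J_def)
  then have "card {h, word_map \<psi> js} = 2" by simp
  then have "2 \<le> card ?S" using card_mono[OF finS, of "{h, word_map \<psi> js}"] js by auto
  moreover have "contracting_similitude (word_map \<psi> ks)" if "ks \<in> J" for ks
    using sim by (rule contracting_similitude_word_map) (use that l(1) in \<open>auto simp: J_def W_def\<close>)
  then have "\<forall>f\<in>?S. contracting_similitude f" using h(1) by blast
  ultimately have gen: "generating_ifs ?S (\<lambda>f. f) K"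
    using finS K compact_K K_nonempty by (auto simp: generating_ifs_def ifs_def is_attractor_def)
  have "f ` K \<inter> g ` K = {}" if fg: "f \<in> ?S" "g \<in> ?S" "f \<noteq> g" for f g
  proof -
    have hJ: "word_map \<psi> ks ` K \<inter> h ` K = {}" if "ks \<in> J" for ks using that by (simp add: J_def)
    have JJ: "word_map \<psi> ks ` K \<inter> word_map \<psi> ks' ` K = {}"
      if "ks \<in> J" "ks' \<in> J" "ks \<noteq> ks'" for ks ks'
      using disjoint_family_onD[OF disjW, of ks ks'] that by (simp add: J_def)
    \<comment> \<open>The index set consists of maps, so \<open>f \<noteq> g\<close> forces the
      words to differ, and different words in \<open>J\<close> have disjoint cylinders.\<close>
    consider "f = h" "g \<in> word_map \<psi> ` J" | "g = h" "f \<in> word_map \<psi> ` J"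
      | ks ks' where "f = word_map \<psi> ks" "g = word_map \<psi> ks'" "ks \<in> J" "ks' \<in> J"
      using fg by blast
    then show ?thesis
    proof cases
      case 1
      then show ?thesis using hJ by auto
    next
      case 2
      then show ?thesis using hJ by auto
    next
      case 3
      then show ?thesis using fg(3) JJ[of ks ks'] by auto
    qed
  qed
  then have "ssc ?S (\<lambda>f. f)" unfolding ssc_def attractor_eq[OF gen] disjoint_family_on_def by blast
  moreover have "J \<subseteq> {js. length js = l \<and> set js \<subseteq> I}" by (auto simp: J_def W_def)
  ultimately show ?thesis using that l(1) gen by blast
qed

text \<open>Conditions (ii) and (iii) speak of families indexed by \<open>{1..m}\<close>. A
  bijective enumeration gives distinct indices distinct maps, so the SSC carries over.\<close>

lemma ssc_ifs_enumerate:
  assumes "generating_ifs S (\<lambda>f. f) K" "ssc S (\<lambda>f. f)"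
  obtains m \<phi> where "generating_ifs {1..m::nat} \<phi> K" "ssc {1..m} \<phi>" "\<phi> ` {1..m} = S"
proof -
  have S: "finite S" "2 \<le> card S" "\<And>f. f \<in> S \<Longrightarrow> contracting_similitude f"
    using assms(1) by (auto simp: generating_ifs_def ifs_def)
  have K: "K \<noteq> {}" "compact K" "K = (\<Union>f\<in>S. f ` K)"
    using assms(1) unfolding generating_ifs_def is_attractor_def by blast+
  obtain \<phi> where "bij_betw \<phi> {1..card S} S" using ex_bij_betw_nat_finite_1[OF S(1)] by blast
  then have img: "\<phi> ` {1..card S} = S" and inj: "inj_on \<phi> {1..card S}"
    by (simp_all add: bij_betw_def)
  have "(\<Union>i\<in>{1..card S}. \<phi> i ` K) = (\<Union>f\<in>\<phi> ` {1..card S}. f ` K)" by (simp only: image_image)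
  also have "\<dots> = K" unfolding img by (rule K(3)[symmetric])
  finally have "is_attractor {1..card S} \<phi> K" using K(1,2) unfolding is_attractor_def by metis
  moreover have "ifs {1..card S} \<phi>"
    using S(2,3) img unfolding ifs_def by (metis card_atLeastAtMost diff_Suc_1 finite_atLeastAtMost imageI)
  ultimately have gen: "generating_ifs {1..card S} \<phi> K" by (simp add: generating_ifs_def)
  have "ssc {1..card S} \<phi>"
    unfolding ssc_def attractor_eq[OF gen] disjoint_family_on_def
  proof (intro ballI impI)
    fix i j assume ij: "i \<in> {1..card S}" "j \<in> {1..card S}" "i \<noteq> j"
    then have "\<phi> i \<in> S" "\<phi> j \<in> S" "\<phi> i \<noteq> \<phi> j" using img inj by (auto dest: inj_onD)
    then show "\<phi> i ` K \<inter> \<phi> j ` K = {}" using disjoint_family_onD[OF ssc_disjoint[OF assms]] by blast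
  qed
  then show ?thesis using that gen img by blast
qed

theorem corollary1p3:
  fixes K :: "(real ^ 'd) set" and h :: "real ^ 'd \<Rightarrow> real ^ 'd"
  assumes "self_similar K"
    and "\<not> is_singleton K"
    and "\<exists>(m::nat) \<phi>. generating_ifs {1..m} \<phi> K \<and> ssc {1..m} \<phi>"
    and "contracting_similitude h"
    and "h ` K \<subseteq> K"
  shows
    "let c_i = openin (top_of_set K) (h ` K);
         c_ii = (\<exists>(m::nat) \<phi>. generating_ifs {1..m} \<phi> K \<and> osc {1..m} \<phi> \<and> h \<in> \<phi> ` {1..m});
         c_iii = (\<exists>(m::nat) \<phi>. generating_ifs {1..m} \<phi> K \<and> ssc {1..m} \<phi> \<and> h \<in> \<phi> ` {1..m})
     in (c_i \<longleftrightarrow> c_ii) \<and> (c_ii \<longleftrightarrow> c_iii) \<and>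
        (c_i \<or> c_ii \<or> c_iii \<longrightarrow>
          (\<forall>(n::nat) \<psi>. generating_ifs {1..n} \<psi> K \<and> ssc {1..n} \<psi> \<longrightarrow>
            (\<exists>l\<ge>1. \<exists>J \<subseteq> {js. length js = l \<and> set js \<subseteq> {1..n}}.
               generating_ifs ({h} \<union> word_map \<psi> ` J) (\<lambda>f. f) K \<and>
               ssc ({h} \<union> word_map \<psi> ` J) (\<lambda>f. f))))"
proof -
  define c_i where "c_i \<longleftrightarrow> openin (top_of_set K) (h ` K)"
  define c_ii where "c_ii \<longleftrightarrow> (\<exists>(m::nat) \<phi>. generating_ifs {1..m} \<phi> K \<and> osc {1..m} \<phi> \<and> h \<in> \<phi> ` {1..m})"
  define c_iii where "c_iii \<longleftrightarrow> (\<exists>(m::nat) \<phi>. generating_ifs {1..m} \<phi> K \<and> ssc {1..m} \<phi> \<and> h \<in> \<phi> ` {1..m})"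
  define words where "words \<longleftrightarrow> (\<forall>(n::nat) \<psi>. generating_ifs {1..n} \<psi> K \<and> ssc {1..n} \<psi> \<longrightarrow>
      (\<exists>l\<ge>1. \<exists>J \<subseteq> {js. length js = l \<and> set js \<subseteq> {1..n}}.
         generating_ifs ({h} \<union> word_map \<psi> ` J) (\<lambda>f. f) K \<and> ssc ({h} \<union> word_map \<psi> ` J) (\<lambda>f. f)))"
  \<comment> \<open>This system serves twice: \<open>words\<close> is applied to it, and it is the
    reference system by which the OSC implies the SSC.\<close>
  obtain m0 :: nat and \<phi>0 where \<phi>0: "generating_ifs {1..m0} \<phi>0 K" "ssc {1..m0} \<phi>0"
    using assms(3) by blast
  have "words" if open_h: "c_i"
    unfolding words_def
  proof (intro allI impI, elim conjE)
    fix n :: nat and \<psi> assume \<psi>: "generating_ifs {1..n} \<psi> K" "ssc {1..n} \<psi>"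
    obtain l J where "1 \<le> l" "J \<subseteq> {js. length js = l \<and> set js \<subseteq> {1..n}}"
      "generating_ifs ({h} \<union> word_map \<psi> ` J) (\<lambda>f. f) K" "ssc ({h} \<union> word_map \<psi> ` J) (\<lambda>f. f)"
      using openin_imp_word_ifs[OF assms(2,4,5) open_h[unfolded c_i_def] \<psi>] .
    then show "\<exists>l\<ge>1. \<exists>J \<subseteq> {js. length js = l \<and> set js \<subseteq> {1..n}}.
         generating_ifs ({h} \<union> word_map \<psi> ` J) (\<lambda>f. f) K \<and> ssc ({h} \<union> word_map \<psi> ` J) (\<lambda>f. f)"
      by blast
  qed
  moreover have "c_iii" if w: "words"
  proof -
    obtain J where J: "generating_ifs ({h} \<union> word_map \<phi>0 ` J) (\<lambda>f. f) K" "ssc ({h} \<union> word_map \<phi>0 ` J) (\<lambda>f. f)"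
      using w \<phi>0 unfolding words_def by blast
    obtain m :: nat and \<phi> where \<phi>: "generating_ifs {1..m} \<phi> K" "ssc {1..m} \<phi>" "\<phi> ` {1..m} = {h} \<union> word_map \<phi>0 ` J"
      using ssc_ifs_enumerate[OF J] .
    then have "h \<in> \<phi> ` {1..m}" by simp
    with \<phi>(1,2) show ?thesis unfolding c_iii_def by blast
  qed
  moreover have "c_ii" if "c_iii"
    using that ssc_imp_osc unfolding c_ii_def c_iii_def by blast
  moreover have "c_iii" if "c_ii"
    using that osc_imp_ssc[OF \<phi>0] unfolding c_ii_def c_iii_def by blast
  moreover have "c_i" if w: "c_iii"
  proof -
    obtain m :: nat and \<phi> i where \<phi>: "generating_ifs {1..m} \<phi> K" "ssc {1..m} \<phi>"
      and i: "i \<in> {1..m}" "h = \<phi> i"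
      using w unfolding c_iii_def by (elim exE conjE imageE)
    show ?thesis unfolding c_i_def i(2) using \<phi> i(1) by (rule ssc_imp_openin)
  qed
  \<comment> \<open>The implications run from \<open>c_i\<close> to \<open>words\<close> to
    \<open>c_iii\<close> and back to \<open>c_i\<close>, with \<open>c_ii\<close> equivalent to
    \<open>c_iii\<close>; thus each condition yields \<open>words\<close>.\<close>
  ultimately have "(c_i \<longleftrightarrow> c_ii) \<and> (c_ii \<longleftrightarrow> c_iii) \<and> (c_i \<or> c_ii \<or> c_iii \<longrightarrow> words)"
    by blast
  then show ?thesis unfolding Let_def c_i_def c_ii_def c_iii_def words_def .
qed

end
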